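(* Let $d\ge1$, $s=\frac d2-\frac2a$ and assume $0<a<1$ and $0<s<1+\frac1a$. Let $\alpha>a$. Then the solution map of $iu_t+\Delta u=\pm|u|^au$ on $\mathbb T^d$ is not locally $\alpha$-Hölder continuous in $H^s(\mathbb T^d)$: there do not exist $\epsilon>0$, $T>0$ and $C<\infty$ such that for all $u_0,v_0\in H^s(\mathbb T^d)$ with $\|u_0\|_{H^s},\|v_0\|_{H^s}<\epsilon$, the corresponding solutions $u,v$ on $[0,T]$ satisfy $\|u-v\|_{C^0([0,T];H^s(\mathbb T^d))}\le C\|u_0-v_0\|_{H^s}^\alpha$.
   Context: $\mathbb T^d=\mathbb R^d/(2\pi\mathbb Z)^d$, $\Delta$ the Laplacian on $\mathbb T^d$. *)

theory Defs
  imports "HOL-Analysis.Analysis"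
begin

text \<open>Functions on the torus T^d = R^d/(2 pi Z)^d are represented as 2pi-periodic
  functions real^'d => complex; the dimension d is CARD('d).\<close>

definition torus_box :: "(real^'d) set" where
  "torus_box = cbox 0 (\<chi> i. 2 * pi)"

definition periodic_torus :: "(real^'d \<Rightarrow> complex) \<Rightarrow> bool" where
  "periodic_torus f \<longleftrightarrow> (\<forall>x j. f (x + (2 * pi) *\<^sub>R axis j 1) = f x)"

definition fcoeff :: "(real^'d \<Rightarrow> complex) \<Rightarrow> int^'d \<Rightarrow> complex" where
  "fcoeff f k = complex_of_real (1 / (2 * pi) ^ CARD('d)) *
     (LINT x:torus_box|lborel. f x * cis (- (\<Sum>i\<in>UNIV. of_int (k $ i) * x $ i)))"

definition ksq :: "int^'d \<Rightarrow> real" where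
  "ksq k = (\<Sum>i\<in>UNIV. (real_of_int (k $ i))^2)"

definition Hs_weight :: "real \<Rightarrow> (real^'d \<Rightarrow> complex) \<Rightarrow> int^'d \<Rightarrow> real" where
  "Hs_weight s f k = (1 + ksq k) powr s * (cmod (fcoeff f k))^2"

definition in_Hs :: "real \<Rightarrow> (real^'d \<Rightarrow> complex) \<Rightarrow> bool" where
  "in_Hs s f \<longleftrightarrow> periodic_torus f \<and> set_borel_measurable lborel torus_box f \<and>
     set_integrable lborel torus_box (\<lambda>x. (cmod (f x))^2) \<and>
     (Hs_weight s f) summable_on UNIV"

definition Hs_norm :: "real \<Rightarrow> (real^'d \<Rightarrow> complex) \<Rightarrow> real" where
  "Hs_norm s f = sqrt (infsum (Hs_weight s f) UNIV)"

definition nonlin :: "real \<Rightarrow> (real^'d \<Rightarrow> complex) \<Rightarrow> (real^'d \<Rightarrow> complex)" where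
  "nonlin a f = (\<lambda>x. complex_of_real (cmod (f x) powr a) * f x)"

text \<open>Mild (Duhamel) solution on [0,T] in C^0([0,T];H^s) of
  i u_t + Laplacian u = mu |u|^a u with u(0) = u0, stated mode by mode:
  hat u(t,k) = e^(-it|k|^2) hat u0(k) - i mu int_0^t e^(-i(t-tau)|k|^2) hat N(tau,k) dtau.\<close>
definition nls_solution ::
  "real \<Rightarrow> real \<Rightarrow> real \<Rightarrow> real \<Rightarrow> (real^'d \<Rightarrow> complex) \<Rightarrow> (real \<Rightarrow> real^'d \<Rightarrow> complex) \<Rightarrow> bool" where
  "nls_solution mu a s T u0 u \<longleftrightarrow>
     (\<forall>t\<in>{0..T}. in_Hs s (u t)) \<and>
     (\<forall>t\<in>{0..T}. ((\<lambda>\<tau>. Hs_norm s (u \<tau> - u t)) \<longlongrightarrow> 0) (at t within {0..T})) \<and>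
     (\<forall>t\<in>{0..T}. set_integrable lborel torus_box (nonlin a (u t))) \<and>
     (\<forall>t\<in>{0..T}. \<forall>k. \<exists>I.
        ((\<lambda>\<tau>. cis (- (t - \<tau>) * ksq k) * fcoeff (nonlin a (u \<tau>)) k) has_integral I) {0..t} \<and>
        fcoeff (u t) k = cis (- t * ksq k) * fcoeff u0 k - \<i> * complex_of_real mu * I)"

end

theory Submission
  imports Defs
begin

text \<open>
  A constant background of size \<open>\<delta>\<close> multiplies a plane wave \<open>A exp(i N x\<^sub>j)\<close> with \<open>A\<close> much smaller
  than \<open>\<delta>\<close> by an extra phase of order \<open>\<delta>\<^sup>a t\<close>, since linearising \<open>|u|\<^sup>a u\<close> at \<open>\<delta>\<close> gives the factor
  \<open>(1 + a/2) \<delta>\<^sup>a\<close>. Choose \<open>A\<close> so that the plane wave has a fixed \<open>H\<^sup>s\<close> norm of order \<open>\<epsilon>\<close>; as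
  \<open>s > 0\<close>, \<open>A\<close> tends to 0 with \<open>N\<close>. The solutions with data \<open>\<delta> + A exp(i N x\<^sub>j)\<close> and
  \<open>A exp(i N x\<^sub>j)\<close> differ by \<open>\<delta>\<close> initially and by at least a multiple of \<open>\<epsilon> \<delta>\<^sup>a T\<close> at time \<open>T\<close>, which
  for small \<open>\<delta>\<close> exceeds \<open>C \<delta>\<^sup>\<alpha>\<close>.

  The second solution is explicit. The first one is \<open>\<delta>\<close> times a rotating constant plus a small wave,
  and the wave is the fixed point of a contraction in a weighted Wiener algebra of functions
  \<open>\<Sum>k. c\<^sub>k(t) exp(i k\<cdot>x)\<close>: near the background the nonlinearity is a convergent power series in the
  wave and its conjugate, and the Duhamel operator acts on each Fourier mode.
\<close>

section \<open>Fourier coefficients\<close>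

text \<open>The theorem quantifies over all solutions \<open>u\<close> and \<open>v\<close>, so one
  badly separated pair refutes the estimate. The obstacles are that \<open>T\<close> is prescribed,
  that s = d/2 - 2/a < d/2, so that H^s does not embed into the bounded functions, and that |u|^a u
  with a < 1 is not twice differentiable at 0. Near a nonzero constant, in an algebra of bounded
  functions, the nonlinearity is real analytic. After division of \<open>u\<close> by \<delta> it
  carries the factor \<delta>^a, so smallness of \<delta>^a T replaces smallness of T in the
  contraction. The order of choices matters. \<delta> comes first, and \<alpha> > a lets \<epsilon>
  \<delta>^a T dominate C \<delta>^\<alpha>. Only then is N taken large, which makes the relative
  amplitude \<kappa> = A / \<delta> small while the H^s size of the plane wave stays \<epsilon>/2.
  The estimates must therefore be uniform in N, although the wave lives at frequency N; this is why
  the weight is rescaled by N and costs only the factor 2^s there.\<close>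

definition character :: "int^'d \<Rightarrow> real^'d \<Rightarrow> complex" where
  "character k x = cis (\<Sum>i\<in>UNIV. of_int (k $ i) * x $ i)"

lemma norm_character [simp]: "cmod (character k x) = 1"
  by (simp add: character_def)

lemma character_0 [simp]: "character 0 x = 1"
  by (simp add: character_def)

lemma character_add: "character (k + l) x = character k x * character l x"
  by (simp add: character_def cis_mult sum.distrib algebra_simps)

lemma character_uminus: "character (- k) x = cnj (character k x)"
  by (simp add: character_def cis_cnj sum_negf)

lemma character_diff: "character (k - l) x = character k x * cnj (character l x)"
  using character_add[of k "- l"] by (simp add: character_uminus)

lemma continuous_on_character [continuous_intros]: "continuous_on S (character k)"
  unfolding character_def by (intro continuous_intros)

lemma cis_of_int_2pi: "cis (of_int n * (2 * pi)) = 1"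
  using cis_multiple_2pi[of "of_int n"] by (simp add: mult.commute mult.left_commute)

lemma character_periodic: "character k (x + (2 * pi) *\<^sub>R axis j 1) = character k x"
proof -
  have "(\<Sum>i\<in>UNIV. real_of_int (k $ i) * (x + (2 * pi) *\<^sub>R axis j 1) $ i)
      = (\<Sum>i\<in>UNIV. of_int (k $ i) * x $ i) + (\<Sum>i\<in>UNIV. of_int (k $ i) * ((2 * pi) * (if i = j then 1 else 0)))"
    by (simp add: sum.distrib[symmetric] algebra_simps axis_def)
  also have "(\<Sum>i\<in>UNIV. real_of_int (k $ i) * ((2 * pi) * (if i = j then 1 else 0))) = of_int (k $ j) * (2 * pi)"
    by (subst sum.remove[of _ j]) auto
  finally show ?thesis
    unfolding character_def by (simp only: cis_mult[symmetric] cis_of_int_2pi mult_1_right)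
qed

section \<open>Orthogonality of the characters\<close>

text \<open>Fubini: \<open>lborel\<close> is the image of the product of one-dimensional Lebesgue
  measures under the coordinate map.\<close>

lemma lborel_integral_prod:
  fixes f :: "'a::euclidean_space \<Rightarrow> real \<Rightarrow> complex"
  assumes "\<And>b. b \<in> Basis \<Longrightarrow> integrable lborel (f b)"
  shows "(LINT x|lborel. (\<Prod>b\<in>Basis. f b (x \<bullet> b))) = (\<Prod>b\<in>Basis. LINT y|lborel. f b y)"
proof -
  interpret product_sigma_finite "\<lambda>_::'a. lborel :: real measure" by standard
  have [measurable]: "f b \<in> borel_measurable borel" if "b \<in> Basis" for b
    using assms[OF that] by (simp add: borel_measurable_integrable)
  have "(LINT x|(lborel::'a measure). (\<Prod>b\<in>Basis. f b (x \<bullet> b)))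
      = (LINT y|(\<Pi>\<^sub>M b\<in>Basis. lborel). (\<Prod>b\<in>Basis. f b ((\<Sum>c\<in>Basis. y c *\<^sub>R c) \<bullet> b)))"
    by (subst lborel_eq, subst integral_distr) auto
  also have "\<dots> = (LINT y|(\<Pi>\<^sub>M b\<in>(Basis::'a set). lborel). (\<Prod>b\<in>Basis. f b (y b)))"
    by (intro Bochner_Integration.integral_cong prod.cong) auto
  also have "\<dots> = (\<Prod>b\<in>Basis. LINT y|lborel. f b y)"
    by (rule product_integral_prod) (use assms in auto)
  finally show ?thesis .
qed

lemma prod_Basis_cart:
  fixes f :: "real^'d \<Rightarrow> 'b::comm_monoid_mult"
  shows "(\<Prod>b\<in>Basis. f b) = (\<Prod>i\<in>UNIV. f (axis i 1))"
proof -
  have "(Basis :: (real^'d) set) = (\<lambda>i. axis i 1) ` UNIV" by (auto simp: Basis_vec_def)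
  moreover have "inj (\<lambda>i::'d. axis i (1::real))" by (auto intro!: injI simp: axis_eq_axis)
  ultimately show ?thesis by (metis prod.reindex_cong)
qed

lemma cis_sum: "cis (\<Sum>i\<in>A. f i) = (\<Prod>i\<in>A. cis (f i))"
  by (induction A rule: infinite_finite_induct) (auto simp: cis_mult[symmetric])

lemma set_integrable_Icc_cis: "set_integrable lborel {0..2*pi} (\<lambda>y. cis (of_int n * y))"
  by (rule borel_integrable_atLeastAtMost') (intro continuous_intros)

lemma integral_cis_Icc:
  "(LINT y:{0..2*pi}|lborel. cis (of_int n * y)) = (if n = 0 then complex_of_real (2 * pi) else 0)"
proof (cases "n = 0")
  case True
  then show ?thesis by (simp add: set_lebesgue_integral_def scaleR_conv_of_real)
next
  case False
  let ?F = "\<lambda>y. cis (of_int n * y) / (\<i> * of_int n)"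
  have "((\<lambda>y. cis (of_int n * y)) has_integral (?F (2*pi) - ?F 0)) {0..2*pi}"
  proof (rule fundamental_theorem_of_calculus)
    fix y :: real
    show "(?F has_vector_derivative cis (of_int n * y)) (at y within {0..2 * pi})"
      using False unfolding cis_conv_exp
      by (auto intro!: derivative_eq_intros has_vector_derivative_real_field simp: field_simps)
  qed simp
  then have "((\<lambda>y. cis (of_int n * y)) has_integral 0) {0..2*pi}"
    by (simp add: cis_of_int_2pi)
  then have "integral {0..2*pi} (\<lambda>y. cis (of_int n * y)) = 0"
    by (rule integral_unique)
  then show ?thesis
    using False set_borel_integral_eq_integral(2)[OF set_integrable_Icc_cis] by simp
qed

lemma integral_character:
  "(LINT x:torus_box|lborel. character (k::int^'d) x) = (if k = 0 then complex_of_real ((2 * pi) ^ CARD('d)) else 0)"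
proof -
  let ?f = "\<lambda>(b::real^'d) y. indicator {0..2*pi} y *\<^sub>R cis (of_int (k $ axis_index b) * y)"
  have "indicator torus_box x *\<^sub>R character k x = (\<Prod>b\<in>Basis. ?f b (x \<bullet> b))" for x
  proof -
    have "(\<Prod>b\<in>Basis. ?f b (x \<bullet> b)) = (\<Prod>i\<in>UNIV. indicator {0..2*pi} (x $ i) *\<^sub>R cis (of_int (k $ i) * x $ i))"
      by (simp only: prod_Basis_cart inner_axis axis_index_axis inner_real_def mult_1_right)
    also have "\<dots> = (\<Prod>i\<in>UNIV. indicator {0..2*pi} (x $ i)) * character k x"
      by (simp only: character_def cis_sum scaleR_conv_of_real prod.distrib of_real_indicator)
    also have "(\<Prod>i\<in>UNIV. indicator {0..2*pi} (x $ i)) = (indicator torus_box x :: complex)"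
      by (auto simp: torus_box_def indicator_def mem_box_cart prod_zero_iff)
    finally show ?thesis by (simp add: indicator_def)
  qed
  then have "(LINT x:torus_box|lborel. character k x) = (\<Prod>b\<in>Basis. LINT y|lborel. ?f b y)"
    unfolding set_lebesgue_integral_def
    using set_integrable_Icc_cis lborel_integral_prod[of ?f] by (simp add: set_integrable_def)
  also have "\<dots> = (\<Prod>b\<in>(Basis::(real^'d) set). if k $ axis_index b = 0 then complex_of_real (2 * pi) else 0)"
    using integral_cis_Icc by (simp add: set_lebesgue_integral_def)
  also have "\<dots> = (\<Prod>i\<in>UNIV. if k $ i = 0 then complex_of_real (2 * pi) else 0)"
    by (simp only: prod_Basis_cart axis_index_axis)
  also have "\<dots> = (if k = 0 then complex_of_real ((2 * pi) ^ CARD('d)) else 0)"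
    by (auto simp: vec_eq_iff prod_zero_iff)
  finally show ?thesis .
qed

lemma compact_torus_box: "compact (torus_box :: (real^'d) set)"
  by (simp add: torus_box_def)

lemma measure_torus_box: "measure lborel (torus_box :: (real^'d) set) = (2 * pi) ^ CARD('d)"
  by (simp add: torus_box_def content_cbox_if_cart interval_ne_empty_cart)

lemma set_integrable_torus_box:
  fixes f :: "real^'d \<Rightarrow> 'b::{banach, second_countable_topology}"
  shows "continuous_on UNIV f \<Longrightarrow> set_integrable lborel torus_box f"
  unfolding set_integrable_def
  by (rule borel_integrable_compact) (auto simp: compact_torus_box intro: continuous_on_subset)

section \<open>Calculus of Fourier coefficients\<close>

lemma fcoeff_alt:
  "fcoeff f k = complex_of_real (1 / (2 * pi) ^ CARD('d)) * (LINT x:torus_box|lborel. f x * cnj (character (k::int^'d) x))"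
  by (simp add: fcoeff_def character_def cis_cnj)

lemma fcoeff_character: "fcoeff (character l) k = (if k = l then 1 else 0)"
  unfolding fcoeff_alt character_diff[symmetric] integral_character by simp

lemma fcoeff_add:
  assumes "continuous_on UNIV f" "continuous_on UNIV g"
  shows "fcoeff (\<lambda>x. f x + g x) k = fcoeff f k + fcoeff g k"
proof -
  have "set_integrable lborel torus_box (\<lambda>x. h x * cnj (character k x))" if "continuous_on UNIV h" for h
    by (intro set_integrable_torus_box continuous_intros that)
  with assms show ?thesis
    by (simp add: fcoeff_alt algebra_simps set_integral_add)
qed

lemma fcoeff_cmult: "fcoeff (\<lambda>x. c * f x) k = c * fcoeff f k"
  by (simp add: fcoeff_alt mult.assoc)

lemma fcoeff_diff:
  assumes "continuous_on UNIV f" "continuous_on UNIV g"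
  shows "fcoeff (\<lambda>x. f x - g x) k = fcoeff f k - fcoeff g k"
  using fcoeff_add[of f "\<lambda>x. -1 * g x" k] fcoeff_cmult[of "-1" g k] assms
  by (simp add: continuous_intros)

lemma fcoeff_const: "fcoeff (\<lambda>x. c) k = (if k = 0 then c else 0)"
  using fcoeff_cmult[of c "character 0" k] by (simp add: fcoeff_character)

lemma fcoeff_const_add:
  assumes "continuous_on UNIV f"
  shows "fcoeff (\<lambda>x. c + f x) k = (if k = 0 then c else 0) + fcoeff f k"
  using fcoeff_add[of "\<lambda>_. c" f k] assms by (simp add: fcoeff_const)

lemma fcoeff_sum:
  assumes "\<And>i. i \<in> A \<Longrightarrow> continuous_on UNIV (f i)"
  shows "fcoeff (\<lambda>x. \<Sum>i\<in>A. f i x) k = (\<Sum>i\<in>A. fcoeff (f i) k)"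
  using assms
proof (induction A rule: infinite_finite_induct)
  case (insert a A)
  then show ?case by (simp add: fcoeff_add continuous_on_sum)
qed (auto simp: fcoeff_alt)

lemma norm_fcoeff_le:
  assumes "continuous_on UNIV (f :: real^'d \<Rightarrow> complex)" and B: "\<And>x. cmod (f x) \<le> B"
  shows "cmod (fcoeff f k) \<le> B"
proof -
  have "cmod (LINT x:torus_box|lborel. f x * cnj (character k x))
      \<le> (LINT x:torus_box|lborel. cmod (f x * cnj (character k x)))"
    by (rule set_integral_norm_bound)
       (intro set_integrable_torus_box continuous_intros assms)
  also have "\<dots> \<le> (LINT x:(torus_box::(real^'d) set)|lborel. B)"
    by (intro set_integral_mono set_integrable_torus_box continuous_intros assms)
       (simp add: norm_mult B)
  also have "\<dots> = B * (2 * pi) ^ CARD('d)"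
    using compact_torus_box[where 'd='d]
    by (simp add: set_lebesgue_integral_def measure_torus_box emeasure_compact_finite less_top[symmetric]
        integral_indicator)
  finally have "cmod (LINT x:torus_box|lborel. f x * cnj (character k x)) \<le> B * (2 * pi) ^ CARD('d)" .
  then show ?thesis
    by (simp add: fcoeff_alt norm_mult norm_divide norm_power field_simps)
qed

text \<open>The majorant makes the series converge uniformly, and \<open>fcoeff\<close> is
  continuous for the sup norm; a finite partial sum has coefficient exactly \<open>c k\<close> as
  soon as it contains \<open>k\<close>. This uniqueness allows the coefficients of any absolutely
  convergent series to be read off as \<open>fcoeff\<close>.\<close>

lemma fcoeff_has_sum:
  fixes f :: "real^'d \<Rightarrow> complex"
  assumes m: "m summable_on UNIV" and c: "\<And>k. cmod (c k) \<le> m k"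
    and f: "\<And>x. ((\<lambda>k. c k * character k x) has_sum f x) UNIV"
  shows "continuous_on UNIV f" and "fcoeff f k = c k"
proof -
  have ul: "uniform_limit UNIV (\<lambda>X x. \<Sum>k\<in>X. c k * character k x) f (finite_subsets_at_top UNIV)"
    by (rule Weierstrass_m_test_general'[OF _ _ m]) (use c f in \<open>auto simp: norm_mult\<close>)
  show cont: "continuous_on UNIV f"
    by (rule uniform_limit_theorem[OF _ ul])
       (auto intro!: always_eventually continuous_intros)
  have "((\<lambda>X. fcoeff (\<lambda>x. \<Sum>k\<in>X. c k * character k x) k) \<longlongrightarrow> fcoeff f k) (finite_subsets_at_top UNIV)"
  proof (rule tendstoI)
    fix e :: real assume "e > 0"
    then have "\<forall>\<^sub>F X in finite_subsets_at_top UNIV. \<forall>x\<in>UNIV. dist (\<Sum>k\<in>X. c k * character k x) (f x) < e / 2"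
      using uniform_limitD[OF ul, of "e/2"] by simp
    then show "\<forall>\<^sub>F X in finite_subsets_at_top UNIV. dist (fcoeff (\<lambda>x. \<Sum>k\<in>X. c k * character k x) k) (fcoeff f k) < e"
    proof eventually_elim
      case (elim X)
      have "cmod (fcoeff (\<lambda>x. (\<Sum>k\<in>X. c k * character k x) - f x) k) \<le> e / 2"
        by (rule norm_fcoeff_le, intro continuous_intros cont)
           (use elim in \<open>auto simp: dist_norm intro!: less_imp_le\<close>)
      also have "fcoeff (\<lambda>x. (\<Sum>k\<in>X. c k * character k x) - f x) k
          = fcoeff (\<lambda>x. \<Sum>k\<in>X. c k * character k x) k - fcoeff f k"
        by (intro fcoeff_diff continuous_intros cont)
      finally show ?case using \<open>e > 0\<close> by (simp add: dist_norm)
    qed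
  qed
  moreover have "\<forall>\<^sub>F X in finite_subsets_at_top UNIV. fcoeff (\<lambda>x. \<Sum>k\<in>X. c k * character k x) k = c k"
    unfolding eventually_finite_subsets_at_top
  proof (intro exI[of _ "{k}"] conjI allI impI)
    fix Y :: "(int^'d) set" assume Y: "finite Y \<and> {k} \<subseteq> Y \<and> Y \<subseteq> UNIV"
    have "fcoeff (\<lambda>x. \<Sum>l\<in>Y. c l * character l x) k = (\<Sum>l\<in>Y. c l * (if k = l then 1 else 0))"
      by (subst fcoeff_sum) (intro continuous_intros, simp only: fcoeff_cmult fcoeff_character)
    also have "\<dots> = c k" using Y by (subst sum.remove[of _ k]) (auto intro!: sum.neutral split: if_splits)
    finally show "fcoeff (\<lambda>x. \<Sum>l\<in>Y. c l * character l x) k = c k" .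
  qed auto
  ultimately have "((\<lambda>_. c k) \<longlongrightarrow> fcoeff f k) (finite_subsets_at_top (UNIV :: (int^'d) set))"
    by (rule Lim_transform_eventually)
  then show "fcoeff f k = c k"
    by (simp add: tendsto_const_iff)
qed

section \<open>A weighted Wiener algebra\<close>

lemma continuous_on_infsum:
  fixes f :: "'i \<Rightarrow> 'a::topological_space \<Rightarrow> 'b::banach"
  assumes "\<And>i. i \<in> X \<Longrightarrow> continuous_on S (f i)"
    and "\<And>i t. i \<in> X \<Longrightarrow> t \<in> S \<Longrightarrow> norm (f i t) \<le> M i" and "M summable_on X"
  shows "continuous_on S (\<lambda>t. \<Sum>\<^sub>\<infinity>i\<in>X. f i t)"
proof (rule uniform_limit_theorem)
  show "uniform_limit S (\<lambda>F t. \<Sum>i\<in>F. f i t) (\<lambda>t. \<Sum>\<^sub>\<infinity>i\<in>X. f i t) (finite_subsets_at_top X)"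
    by (rule Weierstrass_m_test_general) (use assms in auto)
  show "\<forall>\<^sub>F F in finite_subsets_at_top X. continuous_on S (\<lambda>t. \<Sum>i\<in>F. f i t)"
    by (rule eventually_finite_subsets_at_top_weakI) (use assms in \<open>auto intro!: continuous_on_sum\<close>)
qed simp

lemma has_sum_fibers:
  fixes g :: "'i \<Rightarrow> 'b::{real_normed_vector}"
  assumes "(g has_sum S) UNIV" and "\<And>k. (g has_sum h k) {i. \<kappa> i = k}"
  shows "(h has_sum S) UNIV"
proof (rule has_sum_SigmaD)
  show "((\<lambda>(k, i). g i) has_sum S) (Sigma UNIV (\<lambda>k. {i. \<kappa> i = k}))"
    by (rule iffD1[OF has_sum_reindex_bij_witness[where i=snd and j="\<lambda>i. (\<kappa> i, i)" and g=g and S=UNIV] assms(1)]) auto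
  show "((\<lambda>i. (\<lambda>(k, i). g i) (k, i)) has_sum h k) {i. \<kappa> i = k}" for k
    using assms(2) by simp
qed

lemma summable_on_square:
  fixes f :: "'i \<Rightarrow> real"
  assumes "f summable_on UNIV" "\<And>i. 0 \<le> f i"
  shows "(\<lambda>i. (f i)\<^sup>2) summable_on UNIV"
proof (rule summable_on_comparison_test)
  show "(\<lambda>i. infsum f UNIV * f i) summable_on UNIV"
    using assms by (intro summable_on_cmult_right)
  show "(f i)\<^sup>2 \<le> infsum f UNIV * f i" for i
  proof -
    have "sum f {i} \<le> infsum f UNIV"
      by (rule finite_sum_le_infsum) (use assms in auto)
    then show ?thesis by (simp add: power2_eq_square mult_right_mono assms)
  qed
qed simp

text \<open>Submultiplicativity is what makes the weighted l^1 space of coefficients an algebra;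
  evenness makes conjugation an isometry, \<open>W_ge_1\<close> makes the bound control the sup
  norm, and \<open>W_0\<close> lets constants keep their modulus.\<close>

locale wiener_weight =
  fixes T :: real and W :: "int^'d \<Rightarrow> real"
  assumes T_nonneg: "0 \<le> T"
    and W_0: "W 0 = 1"
    and W_ge_1: "1 \<le> W k"
    and W_add: "W (k + l) \<le> W k * W l"
    and W_uminus: "W (- k) = W k"
begin

lemma W_nonneg: "0 \<le> W k" using W_ge_1[of k] by simp

text \<open>The bound over time is taken mode by mode, inside the sum over \<open>k\<close>; hence continuity in time with
  values in \<open>H\<^sup>s\<close> needs only continuity of each coefficient.\<close>
definition wiener_bound :: "real \<Rightarrow> (real \<Rightarrow> real^'d \<Rightarrow> complex) \<Rightarrow> bool" where
  "wiener_bound r f \<longleftrightarrow> (\<exists>c m.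
     (\<forall>k. continuous_on {0..T} (c k)) \<and> (\<forall>k. \<forall>t\<in>{0..T}. cmod (c k t) \<le> m k) \<and>
     (\<lambda>k. W k * m k) summable_on UNIV \<and> (\<Sum>\<^sub>\<infinity>k. W k * m k) \<le> r \<and>
     (\<forall>t\<in>{0..T}. \<forall>x. ((\<lambda>k. c k t * character k x) has_sum f t x) UNIV))"

lemma wiener_boundI:
  assumes "\<And>k. continuous_on {0..T} (c k)" "\<And>k t. t \<in> {0..T} \<Longrightarrow> cmod (c k t) \<le> m k"
    "(\<lambda>k. W k * m k) summable_on UNIV" "(\<Sum>\<^sub>\<infinity>k. W k * m k) \<le> r"
    "\<And>t x. t \<in> {0..T} \<Longrightarrow> ((\<lambda>k. c k t * character k x) has_sum f t x) UNIV"
  shows "wiener_bound r f"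
  unfolding wiener_bound_def
  by (intro exI[of _ c] exI[of _ m] conjI allI ballI) (rule assms, assumption?)+

lemma wiener_bound_mono: "wiener_bound r f \<Longrightarrow> r \<le> r' \<Longrightarrow> wiener_bound r' f"
  unfolding wiener_bound_def by (elim exE conjE, intro exI conjI) (assumption+, linarith, assumption)

lemma wiener_bound_cong:
  assumes "wiener_bound r f" "\<And>t x. t \<in> {0..T} \<Longrightarrow> f t x = g t x"
  shows "wiener_bound r g"
  using assms unfolding wiener_bound_def by simp

lemma majorant_nonneg: "(\<And>t. t \<in> {0..T} \<Longrightarrow> cmod (c t) \<le> b) \<Longrightarrow> 0 \<le> b"
  using T_nonneg norm_ge_zero[of "c 0"] by (meson atLeastAtMost_iff order.refl order_trans)

lemma summable_on_unweighted:
  fixes M :: "'i \<Rightarrow> real"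
  assumes "(\<lambda>i. W (\<kappa> i) * M i) summable_on A" "\<And>i. 0 \<le> M i"
  shows "M summable_on A"
  by (rule summable_on_comparison_test[OF assms(1)])
     (use mult_right_mono[OF W_ge_1 assms(2)] assms(2) in auto)

text \<open>Here \<open>\<kappa>\<close> need not be injective: terms with equal frequency are
  collected, and the triangle inequality on each fibre can only lower the weighted sum. Conjugates,
  frequency shifts and double series all reduce to this form without computing the collected
  coefficients.\<close>

lemma wiener_bound_family:
  fixes a :: "'i \<Rightarrow> real \<Rightarrow> complex" and \<kappa> :: "'i \<Rightarrow> int^'d"
  assumes cont: "\<And>i. continuous_on {0..T} (a i)"
    and bd: "\<And>i t. t \<in> {0..T} \<Longrightarrow> cmod (a i t) \<le> M i"
    and sm: "(\<lambda>i. W (\<kappa> i) * M i) summable_on UNIV" and le: "(\<Sum>\<^sub>\<infinity>i. W (\<kappa> i) * M i) \<le> r"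
    and f: "\<And>t x. t \<in> {0..T} \<Longrightarrow> ((\<lambda>i. a i t * character (\<kappa> i) x) has_sum f t x) UNIV"
  shows "wiener_bound r f"
proof -
  define P where "P k = {i. \<kappa> i = k}" for k
  have M0: "0 \<le> M i" for i using majorant_nonneg[of "a i"] bd by blast
  have M: "M summable_on UNIV" by (rule summable_on_unweighted[OF sm M0])
  have MP: "M summable_on P k" for k by (rule summable_on_subset_banach[OF M]) auto
  have aP: "(\<lambda>i. a i t) summable_on P k" if "t \<in> {0..T}" for t k
    using abs_summable_summable[OF Infinite_Sum.abs_summable_on_comparison_test'[OF MP[of k], of "\<lambda>i. a i t"]] bd that by auto
  define c where "c k t = (\<Sum>\<^sub>\<infinity>i\<in>P k. a i t)" for k t
  define m where "m k = (\<Sum>\<^sub>\<infinity>i\<in>P k. M i)" for k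
  have Wm: "((\<lambda>k. W k * m k) has_sum (\<Sum>\<^sub>\<infinity>i. W (\<kappa> i) * M i)) UNIV"
  proof (rule has_sum_fibers[where \<kappa>=\<kappa>])
    show "((\<lambda>i. W (\<kappa> i) * M i) has_sum infsum (\<lambda>i. W (\<kappa> i) * M i) UNIV) UNIV"
      using sm by simp
    show "((\<lambda>i. W (\<kappa> i) * M i) has_sum W k * m k) {i. \<kappa> i = k}" for k
    proof -
      have "((\<lambda>i. W k * M i) has_sum W k * m k) (P k)"
        unfolding m_def using MP by (intro has_sum_cmult_right) simp
      then show ?thesis unfolding P_def by (rule has_sum_cong[THEN iffD1, rotated]) auto
    qed
  qed
  show ?thesis
  proof (rule wiener_boundI)
    show "continuous_on {0..T} (c k)" for k
      unfolding c_def by (rule continuous_on_infsum[where M=M]) (use cont bd MP in auto)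
    show "cmod (c k t) \<le> m k" if "t \<in> {0..T}" for k t
      unfolding c_def m_def
      using norm_infsum_le[OF has_sum_infsum[OF aP[OF that]] has_sum_infsum[OF MP]] bd that by blast
    show "(\<lambda>k. W k * m k) summable_on UNIV" using Wm by (rule has_sum_imp_summable)
    show "(\<Sum>\<^sub>\<infinity>k. W k * m k) \<le> r" using infsumI[OF Wm] le by simp
    show "((\<lambda>k. c k t * character k x) has_sum f t x) UNIV" if t: "t \<in> {0..T}" for t x
    proof (rule has_sum_fibers[where \<kappa>=\<kappa>])
      show "((\<lambda>i. a i t * character (\<kappa> i) x) has_sum f t x) UNIV" using f t by simp
      show "((\<lambda>i. a i t * character (\<kappa> i) x) has_sum c k t * character k x) {i. \<kappa> i = k}" for k
      proof -
        have "((\<lambda>i. a i t * character k x) has_sum c k t * character k x) (P k)"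
          unfolding c_def using aP t by (intro has_sum_cmult_left) simp
        then show ?thesis unfolding P_def by (rule has_sum_cong[THEN iffD1, rotated]) auto
      qed
    qed
  qed
qed

text \<open>A normal form of \<open>wiener_bound\<close>: the existential coefficients are
  identified with \<open>fcoeff\<close>, so that only the majorant is still to be chosen.\<close>

definition fourier_majorant :: "(int^'d \<Rightarrow> real) \<Rightarrow> (real \<Rightarrow> real^'d \<Rightarrow> complex) \<Rightarrow> bool" where
  "fourier_majorant m f \<longleftrightarrow>
     (\<forall>k. continuous_on {0..T} (\<lambda>t. fcoeff (f t) k)) \<and>
     (\<forall>t\<in>{0..T}. \<forall>k. cmod (fcoeff (f t) k) \<le> m k) \<and> (\<forall>k. 0 \<le> m k) \<and>
     (\<lambda>k. W k * m k) summable_on UNIV \<and>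
     (\<forall>t\<in>{0..T}. \<forall>x. ((\<lambda>k. fcoeff (f t) k * character k x) has_sum f t x) UNIV) \<and>
     (\<forall>t\<in>{0..T}. continuous_on UNIV (f t))"

lemma fourier_majorantD:
  assumes "fourier_majorant m f"
  shows "continuous_on {0..T} (\<lambda>t. fcoeff (f t) k)"
    and "t \<in> {0..T} \<Longrightarrow> cmod (fcoeff (f t) k) \<le> m k"
    and "0 \<le> m k"
    and "(\<lambda>k. W k * m k) summable_on UNIV"
    and "t \<in> {0..T} \<Longrightarrow> ((\<lambda>k. fcoeff (f t) k * character k x) has_sum f t x) UNIV"
    and "t \<in> {0..T} \<Longrightarrow> continuous_on UNIV (f t)"
  using assms unfolding fourier_majorant_def by blast+

lemma wiener_boundE:
  assumes "wiener_bound r f"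
  obtains m where "fourier_majorant m f" "(\<Sum>\<^sub>\<infinity>k. W k * m k) \<le> r"
proof -
  obtain c m where *: "\<And>k. continuous_on {0..T} (c k)" "\<And>k t. t \<in> {0..T} \<Longrightarrow> cmod (c k t) \<le> m k"
    "(\<lambda>k. W k * m k) summable_on UNIV" "(\<Sum>\<^sub>\<infinity>k. W k * m k) \<le> r"
    "\<And>t x. t \<in> {0..T} \<Longrightarrow> ((\<lambda>k. c k t * character k x) has_sum f t x) UNIV"
    using assms unfolding wiener_bound_def by blast
  have m0: "0 \<le> m k" for k using majorant_nonneg[of "c k"] *(2) by blast
  have m: "m summable_on UNIV" by (rule summable_on_unweighted[OF *(3) m0])
  have fc: "fcoeff (f t) k = c k t" if "t \<in> {0..T}" for t k
    by (rule fcoeff_has_sum(2)[OF m *(2)[OF that] *(5)[OF that]])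
  have "continuous_on {0..T} (\<lambda>t. fcoeff (f t) k)" for k
    using *(1)[of k] continuous_on_cong[OF refl, of "{0..T}" "c k" "\<lambda>t. fcoeff (f t) k"] fc by simp
  moreover have "continuous_on UNIV (f t)" if "t \<in> {0..T}" for t
    by (rule fcoeff_has_sum(1)[OF m *(2)[OF that] *(5)[OF that]])
  ultimately have "fourier_majorant m f"
    unfolding fourier_majorant_def using * m0 fc by simp
  then show thesis using *(4) by (rule that)
qed

lemma wiener_bound_continuous: "wiener_bound r f \<Longrightarrow> t \<in> {0..T} \<Longrightarrow> continuous_on UNIV (f t)"
  by (elim wiener_boundE fourier_majorantD(6))

lemma wiener_bound_norm_le:
  assumes "wiener_bound r f" "t \<in> {0..T}"
  shows "cmod (f t x) \<le> r"
proof -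
  obtain m where "fourier_majorant m f" and m_le: "(\<Sum>\<^sub>\<infinity>k. W k * m k) \<le> r"
    using assms(1) by (rule wiener_boundE)
  note m = fourier_majorantD[OF this(1)]
  have "cmod (f t x) \<le> (\<Sum>\<^sub>\<infinity>k. W k * m k)"
  proof (rule norm_infsum_le[OF m(5)[OF assms(2)]])
    show "((\<lambda>k. W k * m k) has_sum (\<Sum>\<^sub>\<infinity>k. W k * m k)) UNIV" using m(4) by simp
    show "cmod (fcoeff (f t) k * character k x) \<le> W k * m k" for k
      using m(2)[OF assms(2), of k] mult_right_mono[OF W_ge_1[of k] m(3)[of k]] by (simp add: norm_mult)
  qed
  with m_le show ?thesis by simp
qed

lemma wiener_bound_nonneg: "wiener_bound r f \<Longrightarrow> 0 \<le> r"
  by (rule order_trans[OF norm_ge_zero wiener_bound_norm_le[of r f 0 undefined]]) (simp_all add: T_nonneg)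

lemma wiener_bound_fcoeff_le:
  assumes "wiener_bound r f" "t \<in> {0..T}"
  shows "cmod (fcoeff (f t) k) \<le> r"
  by (rule norm_fcoeff_le) (use assms wiener_bound_continuous wiener_bound_norm_le in auto)

lemma wiener_bound_character:
  assumes "continuous_on {0..T} g" "\<And>t. t \<in> {0..T} \<Longrightarrow> cmod (g t) \<le> b"
  shows "wiener_bound (W k * b) (\<lambda>t x. g t * character k x)"
proof (rule wiener_bound_family[where \<kappa>="\<lambda>_::unit. k" and M = "\<lambda>_. b"])
  show "((\<lambda>i::unit. g t * character k x) has_sum g t * character k x) UNIV" for t x
    by (simp add: has_sum_finiteI)
qed (use assms in auto)

lemma wiener_bound_const:
  assumes "continuous_on {0..T} g" "\<And>t. t \<in> {0..T} \<Longrightarrow> cmod (g t) \<le> b"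
  shows "wiener_bound b (\<lambda>t x. g t)"
  using wiener_bound_character[OF assms, of 0] by (simp add: W_0)

lemma wiener_bound_0: "wiener_bound 0 (\<lambda>t x. 0)"
  using wiener_bound_character[of "\<lambda>_. 0" 0 0] by simp

lemma wiener_bound_add:
  assumes f: "wiener_bound r f" and g: "wiener_bound q g"
  shows "wiener_bound (r + q) (\<lambda>t x. f t x + g t x)"
proof -
  obtain m where "fourier_majorant m f" and m_le: "(\<Sum>\<^sub>\<infinity>k. W k * m k) \<le> r"
    using f by (rule wiener_boundE)
  note m = fourier_majorantD[OF this(1)]
  obtain n where "fourier_majorant n g" and n_le: "(\<Sum>\<^sub>\<infinity>k. W k * n k) \<le> q"
    using g by (rule wiener_boundE)
  note n = fourier_majorantD[OF this(1)]
  show ?thesis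
  proof (rule wiener_boundI[where c="\<lambda>k t. fcoeff (f t) k + fcoeff (g t) k" and m="\<lambda>k. m k + n k"])
    show "((\<lambda>k. (fcoeff (f t) k + fcoeff (g t) k) * character k x) has_sum f t x + g t x) UNIV"
      if "t \<in> {0..T}" for t x
      using has_sum_add[OF m(5)[OF that] n(5)[OF that]] by (simp add: algebra_simps)
    show "(\<lambda>k. W k * (m k + n k)) summable_on UNIV"
      using summable_on_add[OF m(4) n(4)] by (simp add: algebra_simps)
    show "(\<Sum>\<^sub>\<infinity>k. W k * (m k + n k)) \<le> r + q"
      using infsum_add[OF m(4) n(4)] m_le n_le by (simp add: algebra_simps)
  qed (use m n in \<open>auto intro!: continuous_on_add norm_triangle_mono\<close>)
qed

lemma wiener_bound_cmult:
  assumes f: "wiener_bound r f" and h: "continuous_on {0..T} h" "\<And>t. t \<in> {0..T} \<Longrightarrow> cmod (h t) \<le> b"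
  shows "wiener_bound (b * r) (\<lambda>t x. h t * f t x)"
proof -
  obtain m where "fourier_majorant m f" and m_le: "(\<Sum>\<^sub>\<infinity>k. W k * m k) \<le> r"
    using f by (rule wiener_boundE)
  note m = fourier_majorantD[OF this(1)]
  have b: "0 \<le> b" using h(2) by (rule majorant_nonneg)
  show ?thesis
  proof (rule wiener_boundI[where c="\<lambda>k t. h t * fcoeff (f t) k" and m="\<lambda>k. b * m k"])
    show "((\<lambda>k. (h t * fcoeff (f t) k) * character k x) has_sum h t * f t x) UNIV"
      if "t \<in> {0..T}" for t x
      using has_sum_cmult_right[OF m(5)[OF that]] by (simp add: mult.assoc)
    show "(\<lambda>k. W k * (b * m k)) summable_on UNIV"
      using summable_on_cmult_right[OF m(4), of b] by (simp add: mult_ac)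
    have "(\<Sum>\<^sub>\<infinity>k. W k * (b * m k)) = b * (\<Sum>\<^sub>\<infinity>k. W k * m k)"
      by (subst infsum_cmult_right'[symmetric]) (simp add: mult_ac)
    then show "(\<Sum>\<^sub>\<infinity>k. W k * (b * m k)) \<le> b * r"
      using m_le b by (simp add: mult_left_mono)
  qed (use m h b in \<open>auto intro!: continuous_intros mult_mono simp: norm_mult\<close>)
qed

lemma wiener_bound_scale: "wiener_bound r f \<Longrightarrow> wiener_bound (cmod c * r) (\<lambda>t x. c * f t x)"
  by (rule wiener_bound_cmult) auto

lemma wiener_bound_diff:
  "wiener_bound r f \<Longrightarrow> wiener_bound q g \<Longrightarrow> wiener_bound (r + q) (\<lambda>t x. f t x - g t x)"
  using wiener_bound_add[OF _ wiener_bound_scale[of q g "-1"]] by simp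

lemma wiener_bound_cnj:
  assumes f: "wiener_bound r f"
  shows "wiener_bound r (\<lambda>t x. cnj (f t x))"
proof -
  obtain m where "fourier_majorant m f" and m_le: "(\<Sum>\<^sub>\<infinity>k. W k * m k) \<le> r"
    using f by (rule wiener_boundE)
  note m = fourier_majorantD[OF this(1)]
  show ?thesis
  proof (rule wiener_bound_family[where a="\<lambda>k t. cnj (fcoeff (f t) k)" and \<kappa>=uminus and M=m])
    show "((\<lambda>k. cnj (fcoeff (f t) k) * character (- k) x) has_sum cnj (f t x)) UNIV" if "t \<in> {0..T}" for t x
      using has_sum_cnj_iff[THEN iffD2, OF m(5)[OF that]] by (simp add: character_uminus)
  qed (use m m_le in \<open>auto simp: W_uminus intro!: continuous_intros\<close>)
qed

lemma wiener_bound_mult_character: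
  assumes f: "wiener_bound r f"
  shows "wiener_bound (W l * r) (\<lambda>t x. character l x * f t x)"
proof -
  obtain m where "fourier_majorant m f" and m_le: "(\<Sum>\<^sub>\<infinity>k. W k * m k) \<le> r"
    using f by (rule wiener_boundE)
  note m = fourier_majorantD[OF this(1)]
  have le: "W (l + k) * m k \<le> W l * (W k * m k)" for k
    using mult_right_mono[OF W_add m(3)] by (simp add: mult.assoc)
  have sW: "(\<lambda>k. W l * (W k * m k)) summable_on UNIV"
    by (intro summable_on_cmult_right m)
  have sm: "(\<lambda>k. W (l + k) * m k) summable_on UNIV"
    by (rule summable_on_comparison_test[OF sW]) (use le m W_nonneg in auto)
  show ?thesis
  proof (rule wiener_bound_family[where a="\<lambda>k t. fcoeff (f t) k" and \<kappa>="\<lambda>k. l + k" and M=m])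
    show "((\<lambda>k. fcoeff (f t) k * character (l + k) x) has_sum character l x * f t x) UNIV" if "t \<in> {0..T}" for t x
      using has_sum_cmult_right[OF m(5)[OF that], of "character l x" x] by (simp add: character_add mult_ac)
    have "(\<Sum>\<^sub>\<infinity>k. W (l + k) * m k) \<le> (\<Sum>\<^sub>\<infinity>k. W l * (W k * m k))"
      using sm sW le by (rule infsum_mono)
    also have "\<dots> \<le> W l * r"
      using m_le W_nonneg by (simp add: infsum_cmult_right' mult_left_mono)
    finally show "(\<Sum>\<^sub>\<infinity>k. W (l + k) * m k) \<le> W l * r" .
  qed (use m sm in auto)
qed

text \<open>This stands in for completeness of the algebra. Expanding every \<open>f i\<close> gives
  a double series over pairs \<open>(i, k)\<close>, summed absolutely and then regrouped by the
  frequency \<open>k\<close>. It serves for products, for the power series of the nonlinearity and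
  for the limit of the iteration.\<close>

lemma wiener_bound_infsum:
  fixes f :: "'i \<Rightarrow> real \<Rightarrow> real^'d \<Rightarrow> complex"
  assumes f: "\<And>i. wiener_bound (r i) (f i)" and r: "(r has_sum R) UNIV"
    and F: "\<And>t x. t \<in> {0..T} \<Longrightarrow> ((\<lambda>i. f i t x) has_sum F t x) UNIV"
  shows "wiener_bound R F"
proof -
  have "\<exists>m. fourier_majorant m (f i) \<and> (\<Sum>\<^sub>\<infinity>k. W k * m k) \<le> r i" for i
    using f[of i] by (elim wiener_boundE) blast
  then obtain m where *: "\<And>i. fourier_majorant (m i) (f i)" and m_le: "\<And>i. (\<Sum>\<^sub>\<infinity>k. W k * m i k) \<le> r i"
    by metis
  note m = fourier_majorantD[OF *]
  have Wm0: "0 \<le> W k * m i k" for i k using W_nonneg m(3) by simp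
  define S where "S i = (\<Sum>\<^sub>\<infinity>k. W k * m i k)" for i
  have S: "S summable_on UNIV"
    by (rule summable_on_comparison_test[OF has_sum_imp_summable[OF r]])
       (auto simp: S_def m_le intro!: infsum_nonneg Wm0)
  have inner: "((\<lambda>k. W k * m i k) has_sum S i) UNIV" for i
    unfolding S_def using m(4) by simp
  have sm: "(\<lambda>(i, k). W k * m i k) summable_on Sigma UNIV (\<lambda>_. UNIV)"
    by (rule summable_on_SigmaI[where g=S]) (use inner S Wm0 in auto)
  have hs: "((\<lambda>(i, k). W k * m i k) has_sum infsum S UNIV) (Sigma UNIV (\<lambda>_. UNIV))"
    by (rule has_sum_SigmaI[where g=S]) (use inner S sm in auto)
  show ?thesis
  proof (rule wiener_bound_family[where a="\<lambda>(i, k) t. fcoeff (f i t) k" and \<kappa>=snd and M="\<lambda>(i, k). m i k"])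
    show "(\<lambda>p. W (snd p) * (case p of (i, k) \<Rightarrow> m i k)) summable_on UNIV"
      using sm by (simp add: case_prod_unfold)
    have "(\<Sum>\<^sub>\<infinity>p. W (snd p) * (case p of (i, k) \<Rightarrow> m i k)) = infsum S UNIV"
      using infsumI[OF hs] by (simp add: case_prod_unfold)
    also have "\<dots> \<le> R"
      using infsum_mono[OF S has_sum_imp_summable[OF r]] infsumI[OF r] m_le by (simp add: S_def)
    finally show "(\<Sum>\<^sub>\<infinity>p. W (snd p) * (case p of (i, k) \<Rightarrow> m i k)) \<le> R" .
    show "((\<lambda>p. (case p of (i, k) \<Rightarrow> \<lambda>t. fcoeff (f i t) k) t * character (snd p) x) has_sum F t x) UNIV"
      if t: "t \<in> {0..T}" for t x
    proof -
      have "((\<lambda>(i, k). fcoeff (f i t) k * character k x) has_sum F t x) (Sigma UNIV (\<lambda>_. UNIV))"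
      proof (rule has_sum_SigmaI)
        show "((\<lambda>k. case (i, k) of (i, k) \<Rightarrow> fcoeff (f i t) k * character k x) has_sum f i t x) UNIV" for i
          using m(5)[OF t] by simp
        show "((\<lambda>i. f i t x) has_sum F t x) UNIV" using F t by simp
        show "(\<lambda>(i, k). fcoeff (f i t) k * character k x) summable_on Sigma UNIV (\<lambda>_. UNIV)"
        proof (rule abs_summable_summable[OF Infinite_Sum.abs_summable_on_comparison_test'[OF sm]], clarify)
          show "cmod (fcoeff (f i t) k * character k x) \<le> W k * m i k" for i k
            using m(2)[OF t, of i k] mult_right_mono[OF W_ge_1[of k] m(3)[of i k]] by (simp add: norm_mult)
        qed
      qed
      then show ?thesis by (simp add: case_prod_unfold)
    qed
  qed (use m in auto)
qed

text \<open>Expanding \<open>f\<close> alone turns the product into a sum of frequency shifts of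
  \<open>g\<close>; the shift by \<open>k\<close> costs \<open>W k\<close>, which is just the weight
  carried by the coefficient of \<open>f\<close> at \<open>k\<close>.\<close>

lemma wiener_bound_mult:
  assumes f: "wiener_bound r f" and g: "wiener_bound q g"
  shows "wiener_bound (r * q) (\<lambda>t x. f t x * g t x)"
proof -
  obtain m where "fourier_majorant m f" and m_le: "(\<Sum>\<^sub>\<infinity>k. W k * m k) \<le> r"
    using f by (rule wiener_boundE)
  note m = fourier_majorantD[OF this(1)]
  have "wiener_bound ((\<Sum>\<^sub>\<infinity>k. W k * m k) * q) (\<lambda>t x. f t x * g t x)"
  proof (rule wiener_bound_infsum[where f="\<lambda>k t x. fcoeff (f t) k * (character k x * g t x)"])
    show "wiener_bound (m k * (W k * q)) (\<lambda>t x. fcoeff (f t) k * (character k x * g t x))" for k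
      using m by (intro wiener_bound_cmult wiener_bound_mult_character g) auto
    show "((\<lambda>k. m k * (W k * q)) has_sum (\<Sum>\<^sub>\<infinity>k. W k * m k) * q) UNIV"
      using has_sum_cmult_left[OF has_sum_infsum[OF m(4)], of q] by (simp add: mult_ac)
    show "((\<lambda>k. fcoeff (f t) k * (character k x * g t x)) has_sum f t x * g t x) UNIV" if "t \<in> {0..T}" for t x
      using has_sum_cmult_left[OF m(5)[OF that], of x "g t x"] by (simp add: mult_ac)
  qed
  then show ?thesis
    by (rule wiener_bound_mono) (use m_le wiener_bound_nonneg[OF g] in \<open>simp add: mult_right_mono\<close>)
qed

section \<open>The Duhamel operator\<close>

definition duhamel :: "(real \<Rightarrow> real^'d \<Rightarrow> complex) \<Rightarrow> real \<Rightarrow> real^'d \<Rightarrow> complex" where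
  "duhamel f t x = (\<Sum>\<^sub>\<infinity>k. integral {0..t} (\<lambda>\<tau>. cis (- (t - \<tau>) * ksq k) * fcoeff (f \<tau>) k) * character k x)"

lemma duhamel_integrable:
  assumes f: "wiener_bound r f" and t: "t \<in> {0..T}"
  shows "(\<lambda>\<tau>. cis (- (t - \<tau>) * ksq k) * fcoeff (f \<tau>) k) integrable_on {0..t}"
proof (rule integrable_continuous_interval)
  have "continuous_on {0..t} (\<lambda>\<tau>. fcoeff (f \<tau>) k)"
    using f t by (elim wiener_boundE) (rule continuous_on_subset[OF fourier_majorantD(1)], auto)
  then show "continuous_on {0..t} (\<lambda>\<tau>. cis (- (t - \<tau>) * ksq k) * fcoeff (f \<tau>) k)"
    by (intro continuous_intros)
qed

lemma norm_duhamel_integral_le: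
  assumes f: "wiener_bound r f" and t: "t \<in> {0..T}" and b: "\<And>\<tau>. \<tau> \<in> {0..t} \<Longrightarrow> cmod (fcoeff (f \<tau>) k) \<le> b"
  shows "cmod (integral {0..t} (\<lambda>\<tau>. cis (- (t - \<tau>) * ksq k) * fcoeff (f \<tau>) k)) \<le> t * b"
proof -
  have "cmod (integral {0..t} (\<lambda>\<tau>. cis (- (t - \<tau>) * ksq k) * fcoeff (f \<tau>) k)) \<le> integral {0..t} (\<lambda>_. b)"
    by (rule integral_norm_bound_integral[OF duhamel_integrable[OF f t]]) (use b in \<open>auto simp: norm_mult\<close>)
  then show ?thesis using t by simp
qed

text \<open>The propagator multiplies each mode by a number of modulus 1, so majorants survive and
  only the length of the time interval is lost.\<close>

lemma wiener_bound_duhamel: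
  assumes f: "wiener_bound r f"
  shows "wiener_bound (T * r) (duhamel f)"
    and "t \<in> {0..T} \<Longrightarrow> fcoeff (duhamel f t) k = integral {0..t} (\<lambda>\<tau>. cis (- (t - \<tau>) * ksq k) * fcoeff (f \<tau>) k)"
proof -
  obtain m where "fourier_majorant m f" and m_le: "(\<Sum>\<^sub>\<infinity>k. W k * m k) \<le> r"
    using f by (rule wiener_boundE)
  note m = fourier_majorantD[OF this(1)]
  let ?c = "\<lambda>k t. integral {0..t} (\<lambda>\<tau>. cis (- (t - \<tau>) * ksq k) * fcoeff (f \<tau>) k)"
  have bd: "cmod (?c k t) \<le> T * m k" if t: "t \<in> {0..T}" for k t
  proof -
    have "cmod (?c k t) \<le> t * m k"
      by (rule norm_duhamel_integral_le[OF f t]) (use m(2) t in auto)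
    also have "\<dots> \<le> T * m k" using t m(3) by (simp add: mult_right_mono)
    finally show ?thesis .
  qed
  have ms: "(\<lambda>k. T * m k) summable_on UNIV"
    by (intro summable_on_cmult_right summable_on_unweighted[OF m(4) m(3)])
  have hs: "((\<lambda>k. ?c k t * character k x) has_sum duhamel f t x) UNIV" if t: "t \<in> {0..T}" for t x
    unfolding duhamel_def
    by (intro has_sum_infsum abs_summable_summable[OF Infinite_Sum.abs_summable_on_comparison_test'[OF ms]])
       (use bd[OF t] in \<open>simp add: norm_mult\<close>)
  show "wiener_bound (T * r) (duhamel f)"
  proof (rule wiener_boundI[OF _ bd _ _ hs])
    fix k :: "int^'d"
    \<comment> \<open>The time \<open>t\<close> occurs both in the integrand and as upper limit.
      Splitting the phase leaves a fixed integrand, to which continuity of the indefinite integral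
      applies.\<close>
    have eq: "?c k t = cis (- t * ksq k) * integral {0..t} (\<lambda>\<tau>. cis (\<tau> * ksq k) * fcoeff (f \<tau>) k)" for t
    proof -
      have "cis (- (t - \<tau>) * ksq k) = cis (- t * ksq k) * cis (\<tau> * ksq k)" for \<tau>
        by (simp add: cis_mult algebra_simps)
      then show ?thesis by (simp only: mult.assoc integral_mult_right)
    qed
    have "(\<lambda>\<tau>. cis (\<tau> * ksq k) * fcoeff (f \<tau>) k) integrable_on {0..T}"
      by (intro integrable_continuous_interval continuous_intros m)
    then show "continuous_on {0..T} (?c k)"
      unfolding eq by (intro continuous_intros indefinite_integral_continuous_1)
  next
    show "(\<lambda>k. W k * (T * m k)) summable_on UNIV"
      using summable_on_cmult_right[OF m(4), of T] by (simp add: mult_ac)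
    have "(\<Sum>\<^sub>\<infinity>k. W k * (T * m k)) = T * (\<Sum>\<^sub>\<infinity>k. W k * m k)"
      by (subst infsum_cmult_right'[symmetric]) (simp add: mult_ac)
    then show "(\<Sum>\<^sub>\<infinity>k. W k * (T * m k)) \<le> T * r" using m_le T_nonneg by (simp add: mult_left_mono)
  qed
  show "fcoeff (duhamel f t) k = ?c k t" if t: "t \<in> {0..T}"
    by (rule fcoeff_has_sum(2)[OF ms bd[OF t] hs[OF t]])
qed

lemma duhamel_diff:
  assumes f: "wiener_bound r f" and g: "wiener_bound q g" and t: "t \<in> {0..T}"
  shows "duhamel f t x - duhamel g t x = duhamel (\<lambda>t x. f t x - g t x) t x"
proof -
  let ?h = "\<lambda>t x. f t x - g t x"
  have h: "wiener_bound (r + q) ?h" by (rule wiener_bound_diff[OF f g])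
  have "fcoeff (duhamel f t) k - fcoeff (duhamel g t) k = fcoeff (duhamel ?h t) k" for k
  proof -
    have *: "fcoeff (?h \<tau>) k = fcoeff (f \<tau>) k - fcoeff (g \<tau>) k" if "\<tau> \<in> {0..t}" for \<tau>
      by (rule fcoeff_diff) (use f g t that in \<open>auto intro: wiener_bound_continuous\<close>)
    have "integral {0..t} (\<lambda>\<tau>. cis (- (t - \<tau>) * ksq k) * fcoeff (?h \<tau>) k)
        = integral {0..t} (\<lambda>\<tau>. cis (- (t - \<tau>) * ksq k) * fcoeff (f \<tau>) k - cis (- (t - \<tau>) * ksq k) * fcoeff (g \<tau>) k)"
      by (rule integral_cong) (simp add: * algebra_simps)
    also have "\<dots> = integral {0..t} (\<lambda>\<tau>. cis (- (t - \<tau>) * ksq k) * fcoeff (f \<tau>) k)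
       - integral {0..t} (\<lambda>\<tau>. cis (- (t - \<tau>) * ksq k) * fcoeff (g \<tau>) k)"
      by (rule integral_diff) (rule duhamel_integrable[OF f t] duhamel_integrable[OF g t])+
    finally show ?thesis
      by (simp only: wiener_bound_duhamel(2)[OF f t] wiener_bound_duhamel(2)[OF g t] wiener_bound_duhamel(2)[OF h t])
  qed
  moreover have "((\<lambda>k. fcoeff (duhamel u t) k * character k x) has_sum duhamel u t x) UNIV"
    if "wiener_bound p u" for p u
    using wiener_bound_duhamel(1)[OF that] t by (elim wiener_boundE fourier_majorantD(5))
  note hs = this
  have "((\<lambda>k. fcoeff (duhamel f t) k * character k x - fcoeff (duhamel g t) k * character k x)
     has_sum duhamel f t x - duhamel g t x) UNIV"
    using has_sum_add[OF hs[OF f] has_sum_uminusI[OF hs[OF g]]] by simp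
  ultimately have "((\<lambda>k. fcoeff (duhamel ?h t) k * character k x) has_sum duhamel f t x - duhamel g t x) UNIV"
    by (simp add: algebra_simps)
  with hs[OF h] show ?thesis by (rule has_sum_unique[rotated])
qed

lemma wiener_bound_eq_0:
  assumes "\<And>e. e > 0 \<Longrightarrow> wiener_bound e f" "t \<in> {0..T}"
  shows "f t x = 0"
proof -
  have "cmod (f t x) \<le> 0 + e" if "e > 0" for e
    using wiener_bound_norm_le[OF assms(1)[OF that] assms(2)] by simp
  then have "cmod (f t x) \<le> 0" by (rule field_le_epsilon)
  then show ?thesis by simp
qed

end

section \<open>The nonlinearity near a constant\<close>

text \<open>Consecutive coefficients have ratio (\<beta> - n) / (n + 1), of modulus at most 1 for n
  >= 1 but possibly 2 for n = 0. Hence the induction starts at index 1, where the coefficient is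
  \<beta>. The range [0, 2] covers both exponents 1 + a/2 and a/2 used below.\<close>

lemma norm_gbinomial_le_2:
  assumes "0 \<le> \<beta>" "\<beta> \<le> 2"
  shows "cmod (complex_of_real \<beta> gchoose n) \<le> 2"
proof -
  have *: "(complex_of_real \<beta> gchoose Suc n) = (of_real \<beta> gchoose n) * of_real ((\<beta> - real n) / real (Suc n))" for n
    by (simp add: gbinomial_prod_rev field_simps)
  have "cmod (complex_of_real \<beta> gchoose Suc n) \<le> 2" for n
  proof (induction n)
    case 0
    show ?case using assms by simp
  next
    case (Suc n)
    have "\<bar>(\<beta> - real (Suc n)) / real (Suc (Suc n))\<bar> \<le> 1"
      using assms by (auto simp: abs_if field_simps)
    then have "cmod (complex_of_real \<beta> gchoose Suc n) * \<bar>(\<beta> - real (Suc n)) / real (Suc (Suc n))\<bar> \<le> 2 * 1"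
      by (intro mult_mono Suc) auto
    then show ?case by (subst *) (simp only: norm_mult norm_of_real)
  qed
  then show ?thesis by (cases n) auto
qed

lemma gbinomial_has_sum:
  assumes \<beta>: "0 \<le> \<beta>" "\<beta> \<le> 2" and w: "cmod w < 1"
  shows "(\<lambda>n. 2 * cmod w ^ n) summable_on UNIV"
    and "cmod ((complex_of_real \<beta> gchoose n) * w ^ n) \<le> 2 * cmod w ^ n"
    and "((\<lambda>n. (complex_of_real \<beta> gchoose n) * w ^ n) has_sum (1 + w) powr of_real \<beta>) UNIV"
proof -
  have s: "summable (\<lambda>n. 2 * cmod w ^ n)" using w by (intro summable_mult summable_geometric) simp
  then show "(\<lambda>n. 2 * cmod w ^ n) summable_on UNIV"
    by (intro summable_nonneg_imp_summable_on) auto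
  show le: "cmod ((complex_of_real \<beta> gchoose n) * w ^ n) \<le> 2 * cmod w ^ n" for n
    unfolding norm_mult norm_power by (intro mult_right_mono norm_gbinomial_le_2 \<beta>) simp
  show "((\<lambda>n. (complex_of_real \<beta> gchoose n) * w ^ n) has_sum (1 + w) powr of_real \<beta>) UNIV"
    by (rule norm_summable_imp_has_sum[OF summable_comparison_test'[OF s] gen_binomial_complex[OF w]])
       (use le in simp)
qed

lemma has_sum_mult_abs:
  fixes F :: "'i \<Rightarrow> complex" and G :: "'j \<Rightarrow> complex"
  assumes "p summable_on UNIV" "\<And>i. cmod (F i) \<le> p i" "(F has_sum f) UNIV"
    and "q summable_on UNIV" "\<And>j. cmod (G j) \<le> q j" "(G has_sum g) UNIV"
  shows "((\<lambda>(i, j). F i * G j) has_sum f * g) UNIV"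
proof -
  have p0: "0 \<le> p i" for i using assms(2) norm_ge_zero order_trans by blast
  have q0: "0 \<le> q j" for j using assms(5) norm_ge_zero order_trans by blast
  have "(\<lambda>(i, j). p i * q j) summable_on Sigma UNIV (\<lambda>_. UNIV)"
  proof (rule summable_on_SigmaI)
    show "((\<lambda>j. case (i, j) of (i, j) \<Rightarrow> p i * q j) has_sum p i * infsum q UNIV) UNIV" for i
      using assms(4) by (auto intro!: has_sum_cmult_right)
    show "(\<lambda>i. p i * infsum q UNIV) summable_on UNIV"
      using assms(1) by (rule summable_on_cmult_left)
  qed (use p0 q0 in auto)
  then have "(\<lambda>(i, j). F i * G j) summable_on Sigma UNIV (\<lambda>_. UNIV)"
    by (rule abs_summable_summable[OF Infinite_Sum.abs_summable_on_comparison_test'])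
       (auto simp: norm_mult intro!: mult_mono[OF assms(2,5) p0 norm_ge_zero])
  then have "((\<lambda>(i, j). F i * G j) has_sum f * g) (Sigma UNIV (\<lambda>_. UNIV))"
    by (intro has_sum_SigmaI[where g="\<lambda>i. F i * g"])
       (simp_all add: has_sum_cmult_right[OF assms(6)] has_sum_cmult_left[OF assms(3)])
  then show ?thesis by simp
qed

section \<open>Power series of the nonlinearity at 1\<close>

definition power_nl :: "real \<Rightarrow> complex \<Rightarrow> complex" where
  "power_nl a z = complex_of_real (cmod z powr a) * z"

text \<open>Separating \<open>z\<close> from its conjugate exhibits the nonlinearity as a product of
  two binomial series. Any branch of the power works, since only the modulus of z^(a/2) survives in
  the product with its conjugate.\<close>

lemma power_nl_eq_powr:
  assumes "z \<noteq> 0"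
  shows "power_nl a z = z powr of_real (1 + a / 2) * cnj (z powr of_real (a / 2))"
proof -
  have "z powr of_real (1 + a / 2) = z * z powr of_real (a / 2)"
    using assms by (simp add: powr_add)
  then have "z powr of_real (1 + a / 2) * cnj (z powr of_real (a / 2)) = z * of_real ((cmod (z powr of_real (a / 2)))\<^sup>2)"
    by (simp add: complex_norm_square mult.assoc del: of_real_power)
  also have "(cmod (z powr of_real (a / 2)))\<^sup>2 = cmod z powr a"
    using assms by (simp add: norm_powr_real_powr' power2_eq_square powr_add[symmetric])
  finally show ?thesis by (simp add: power_nl_def mult.commute)
qed

text \<open>The coefficient of w^n cnj(w)^m in the expansion of |1 + w|^a (1 + w).\<close>

definition nl_coeff :: "real \<Rightarrow> nat \<times> nat \<Rightarrow> complex" where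
  "nl_coeff a = (\<lambda>(n, m). (of_real (1 + a / 2) gchoose n) * (of_real (a / 2) gchoose m))"

lemma norm_nl_coeff_le:
  assumes "0 \<le> a" "a \<le> 1" shows "cmod (nl_coeff a p) \<le> 4"
proof -
  have "cmod (of_real (1 + a / 2) gchoose fst p) * cmod (complex_of_real (a / 2) gchoose snd p) \<le> 2 * 2"
    using assms by (intro mult_mono norm_gbinomial_le_2) auto
  then show ?thesis by (simp add: nl_coeff_def case_prod_unfold norm_mult)
qed

lemma power_nl_has_sum:
  assumes a: "0 \<le> a" "a \<le> 1" and w: "cmod w < 1"
  shows "((\<lambda>p. nl_coeff a p * (w ^ fst p * cnj w ^ snd p)) has_sum power_nl a (1 + w)) UNIV"
proof -
  note A = gbinomial_has_sum[of "1 + a / 2", OF _ _ w] and B = gbinomial_has_sum[of "a / 2", OF _ _ w]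
  have B': "((\<lambda>m. (complex_of_real (a / 2) gchoose m) * cnj w ^ m) has_sum cnj ((1 + w) powr of_real (a / 2))) UNIV"
  proof -
    have "cnj (complex_of_real (a / 2) gchoose m) = (complex_of_real (a / 2) gchoose m)" for m
      by (simp add: gbinomial_prod_rev)
    moreover have "((\<lambda>m. cnj ((complex_of_real (a / 2) gchoose m) * w ^ m)) has_sum cnj ((1 + w) powr of_real (a / 2))) UNIV"
      using B(3) a by (subst has_sum_cnj_iff) auto
    ultimately show ?thesis by simp
  qed
  have "1 + w \<noteq> 0"
    using w by (metis add_eq_0_iff less_irrefl norm_minus_cancel norm_one)
  have "((\<lambda>(n, m). ((of_real (1 + a / 2) gchoose n) * w ^ n) * ((of_real (a / 2) gchoose m) * cnj w ^ m))
     has_sum (1 + w) powr of_real (1 + a / 2) * cnj ((1 + w) powr of_real (a / 2))) UNIV"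
    by (rule has_sum_mult_abs[OF A(1) A(2) A(3) B(1) _ B'])
       (use a B(2) in \<open>auto simp: norm_mult norm_power\<close>)
  then show ?thesis
    unfolding power_nl_eq_powr[OF \<open>1 + w \<noteq> 0\<close>]
    by (simp add: nl_coeff_def case_prod_unfold mult_ac)
qed

definition nl_remainder :: "real \<Rightarrow> complex \<Rightarrow> complex" where
  "nl_remainder a w = power_nl a (1 + w) - (1 + of_real (1 + a / 2) * w + of_real (a / 2) * cnj w)"

lemma nl_remainder_has_sum:
  assumes a: "0 \<le> a" "a \<le> 1" and w: "cmod w < 1"
  shows "((\<lambda>p. if 2 \<le> fst p + snd p then nl_coeff a p * (w ^ fst p * cnj w ^ snd p) else 0)
           has_sum nl_remainder a w) UNIV"
proof -
  let ?g = "\<lambda>p. nl_coeff a p * (w ^ fst p * cnj w ^ snd p)"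
  let ?F = "{(0, 0), (1, 0), (0, 1)} :: (nat \<times> nat) set"
  have "((\<lambda>p. if p \<in> ?F then ?g p else 0) has_sum sum ?g ?F) UNIV"
    by (rule has_sum_finite_neutralI[where B="?F"]) auto
  then have "((\<lambda>p. if p \<in> ?F then - ?g p else 0) has_sum - sum ?g ?F) UNIV"
    using has_sum_uminusI by (fastforce elim!: has_sum_cong[THEN iffD1, rotated])
  from has_sum_add[OF power_nl_has_sum[OF a w] this]
  have "((\<lambda>p. ?g p + (if p \<in> ?F then - ?g p else 0)) has_sum power_nl a (1 + w) + - sum ?g ?F) UNIV" .
  moreover have "power_nl a (1 + w) + - sum ?g ?F = nl_remainder a w"
    by (simp add: nl_remainder_def nl_coeff_def algebra_simps)
  moreover have "?g p + (if p \<in> ?F then - ?g p else 0) = (if 2 \<le> fst p + snd p then ?g p else 0)" for p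
  proof (cases p)
    case (Pair n m)
    have "(n, m) \<in> ?F \<longleftrightarrow> \<not> 2 \<le> n + m" by auto
    with Pair show ?thesis by auto
  qed
  ultimately show ?thesis by simp
qed

text \<open>A monomial of degree D >= 2 has Lipschitz constant D r^(D-1) on the ball of radius r.
  With r <= 1/2 one factor r is kept and r^(D-2) is at most 4 (1/2)^D; the coefficient bound 4 then
  gives 16.\<close>

definition lipschitz_series :: "nat \<times> nat \<Rightarrow> real" where
  "lipschitz_series p = 16 * (real (fst p + snd p) * (1/2) ^ (fst p + snd p))"

definition lipschitz_const :: real where
  "lipschitz_const = infsum lipschitz_series UNIV"

text \<open>Since n + m <= (n + 1)(m + 1), the double series is dominated by a product of two
  differentiated geometric series.\<close>

lemma lipschitz_series_summable: "lipschitz_series summable_on UNIV"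
proof -
  let ?p = "\<lambda>n::nat. real (Suc n) * (1/2) ^ n"
  have "summable (\<lambda>n. diffs (\<lambda>n. 1::real) n * (1/2) ^ n)"
    by (rule termdiff_converges[of _ 1]) (auto intro!: summable_geometric)
  then have s: "?p summable_on UNIV"
    by (intro summable_nonneg_imp_summable_on) (auto simp: diffs_def)
  have "(\<lambda>(n, m). ?p n * ?p m) summable_on Sigma UNIV (\<lambda>_. UNIV)"
  proof (rule summable_on_SigmaI)
    show "((\<lambda>m. case (n, m) of (n, m) \<Rightarrow> ?p n * ?p m) has_sum ?p n * infsum ?p UNIV) UNIV" for n
      using s has_sum_cmult_right[OF has_sum_infsum[OF s]] by simp
    show "(\<lambda>n. ?p n * infsum ?p UNIV) summable_on UNIV"
      using s by (rule summable_on_cmult_left)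
  qed auto
  then have "(\<lambda>(n, m). 16 * (?p n * ?p m)) summable_on UNIV"
    using summable_on_cmult_right[of _ UNIV "16::real"] by (fastforce simp: case_prod_unfold)
  then show ?thesis
  proof (rule summable_on_comparison_test)
    show "lipschitz_series p \<le> (case p of (n, m) \<Rightarrow> 16 * (?p n * ?p m))" for p
    proof (cases p)
      case (Pair n m)
      have "real (n + m) * (1/2) ^ (n + m) \<le> (real (Suc n) * real (Suc m)) * (1/2) ^ (n + m)"
        by (rule mult_right_mono) (auto simp: algebra_simps)
      also have "\<dots> = ?p n * ?p m" by (simp add: power_add)
      finally show ?thesis using Pair by (simp add: lipschitz_series_def)
    qed
  qed (simp add: lipschitz_series_def)
qed

lemma lipschitz_const_nonneg: "0 \<le> lipschitz_const"
  unfolding lipschitz_const_def by (rule infsum_nonneg) (simp add: lipschitz_series_def)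

section \<open>Lipschitz estimates for the power series\<close>

context wiener_weight
begin

lemma wiener_bound_power: "wiener_bound r f \<Longrightarrow> wiener_bound (r ^ n) (\<lambda>t x. f t x ^ n)"
proof (induction n)
  case 0
  then show ?case by (simp add: wiener_bound_const)
next
  case (Suc n)
  then show ?case by (simp add: wiener_bound_mult)
qed

text \<open>For \<open>n = 0\<close> the truncated exponent \<open>n - 1\<close> does no harm,
  because the factor \<open>real n\<close> vanishes.\<close>

lemma wiener_bound_power_diff:
  assumes "wiener_bound r f" "wiener_bound r g" "wiener_bound d (\<lambda>t x. f t x - g t x)"
  shows "wiener_bound (real n * r ^ (n - 1) * d) (\<lambda>t x. f t x ^ n - g t x ^ n)"
proof (induction n)
  case 0
  show ?case using wiener_bound_0 by simp
next
  case (Suc n)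
  have "wiener_bound (r * (real n * r ^ (n - 1) * d) + d * r ^ n)
     (\<lambda>t x. f t x * (f t x ^ n - g t x ^ n) + (f t x - g t x) * g t x ^ n)"
    by (intro wiener_bound_add wiener_bound_mult wiener_bound_power Suc assms)
  moreover have "r * (real n * r ^ (n - 1) * d) + d * r ^ n = real (Suc n) * r ^ (Suc n - 1) * d"
    by (cases n) (simp_all add: algebra_simps)
  moreover have "(\<lambda>t x. f t x * (f t x ^ n - g t x ^ n) + (f t x - g t x) * g t x ^ n) = (\<lambda>t x. f t x ^ Suc n - g t x ^ Suc n)"
    by (simp add: algebra_simps)
  ultimately show ?case by (simp only:)
qed

lemma wiener_bound_monomial_diff:
  assumes f: "wiener_bound r f" and g: "wiener_bound r g" and d: "wiener_bound d (\<lambda>t x. f t x - g t x)"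
  shows "wiener_bound (real (n + m) * r ^ (n + m - 1) * d)
    (\<lambda>t x. f t x ^ n * cnj (f t x) ^ m - g t x ^ n * cnj (g t x) ^ m)"
proof -
  have d': "wiener_bound d (\<lambda>t x. cnj (f t x) - cnj (g t x))"
    using wiener_bound_cnj[OF d] by simp
  have "wiener_bound (real n * r ^ (n - 1) * d * r ^ m + r ^ n * (real m * r ^ (m - 1) * d))
    (\<lambda>t x. (f t x ^ n - g t x ^ n) * cnj (f t x) ^ m + g t x ^ n * (cnj (f t x) ^ m - cnj (g t x) ^ m))"
    by (intro wiener_bound_add wiener_bound_mult wiener_bound_power wiener_bound_power_diff wiener_bound_cnj f g d d')
  moreover have "real n * r ^ (n - 1) * d * r ^ m + r ^ n * (real m * r ^ (m - 1) * d) = real (n + m) * r ^ (n + m - 1) * d"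
    by (cases n; cases m) (simp_all add: power_add algebra_simps)
  moreover have "(\<lambda>t x. (f t x ^ n - g t x ^ n) * cnj (f t x) ^ m + g t x ^ n * (cnj (f t x) ^ m - cnj (g t x) ^ m))
      = (\<lambda>t x. f t x ^ n * cnj (f t x) ^ m - g t x ^ n * cnj (g t x) ^ m)"
    by (simp add: algebra_simps)
  ultimately show ?thesis by (simp only:)
qed

text \<open>Only terms of degree at least 2 remain, so the Lipschitz constant on the ball of radius
  \<open>r\<close> carries a factor \<open>r\<close>. This makes the remainder negligible against
  the linear part when \<open>r\<close> is small.\<close>

lemma wiener_bound_nl_remainder_diff:
  assumes a: "0 \<le> a" "a \<le> 1" and r: "r \<le> 1/2"
    and f: "wiener_bound r f" and g: "wiener_bound r g" and d: "wiener_bound d (\<lambda>t x. f t x - g t x)"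
  shows "wiener_bound (lipschitz_const * r * d) (\<lambda>t x. nl_remainder a (f t x) - nl_remainder a (g t x))"
proof (rule wiener_bound_infsum)
  let ?h = "\<lambda>p w. if 2 \<le> fst p + snd p then nl_coeff a p * (w ^ fst p * cnj w ^ snd p) else 0"
  have r0: "0 \<le> r" and d0: "0 \<le> d" using f d wiener_bound_nonneg by auto
  show "wiener_bound (lipschitz_series p * (r * d)) (\<lambda>t x. ?h p (f t x) - ?h p (g t x))" for p
  proof (cases "2 \<le> fst p + snd p")
    case True
    \<comment> \<open>With the degree written as \<open>k + 2\<close>, the power
      \<open>r ^ (degree - 1)\<close> splits into \<open>r ^ k\<close>, compared with
      \<open>(1/2) ^ k\<close>, and the one factor \<open>r\<close> that is to be kept.\<close>
    define k where "k = fst p + snd p - 2"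
    have k: "fst p + snd p = k + 2" using True by (simp add: k_def)
    have "wiener_bound (cmod (nl_coeff a p) * (real (fst p + snd p) * r ^ (fst p + snd p - 1) * d))
       (\<lambda>t x. nl_coeff a p * (f t x ^ fst p * cnj (f t x) ^ snd p - g t x ^ fst p * cnj (g t x) ^ snd p))"
      by (intro wiener_bound_scale wiener_bound_monomial_diff f g d)
    then have "wiener_bound (cmod (nl_coeff a p) * (real (fst p + snd p) * r ^ (fst p + snd p - 1) * d)) (\<lambda>t x. ?h p (f t x) - ?h p (g t x))"
      using True by (simp add: algebra_simps)
    moreover have "cmod (nl_coeff a p) * (real (fst p + snd p) * r ^ (fst p + snd p - 1) * d) \<le> lipschitz_series p * (r * d)"
    proof -
      have "r ^ k \<le> (1/2) ^ k" using r r0 by (rule power_mono)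
      then have "r ^ k * (r * d) \<le> (1/2) ^ k * (r * d)"
        by (rule mult_right_mono) (use r0 d0 in simp)
      then have "real (k + 2) * (r ^ k * (r * d)) \<le> real (k + 2) * ((1/2) ^ k * (r * d))"
        by (rule mult_left_mono) simp
      then have "cmod (nl_coeff a p) * (real (k + 2) * (r ^ k * (r * d))) \<le> 4 * (real (k + 2) * ((1/2) ^ k * (r * d)))"
        by (rule mult_mono[OF norm_nl_coeff_le[OF a]]) (use r0 d0 in auto)
      then show ?thesis by (simp add: lipschitz_series_def k mult_ac power_add)
    qed
    ultimately show ?thesis by (rule wiener_bound_mono)
  next
    case False
    have "wiener_bound (lipschitz_series p * (r * d)) (\<lambda>t x. 0)"
      by (rule wiener_bound_mono[OF wiener_bound_0]) (use r0 d0 in \<open>simp add: lipschitz_series_def\<close>)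
    with False show ?thesis by simp
  qed
  show "((\<lambda>p. lipschitz_series p * (r * d)) has_sum lipschitz_const * r * d) UNIV"
    using has_sum_cmult_left[OF has_sum_infsum[OF lipschitz_series_summable], of "r * d"]
    by (simp add: lipschitz_const_def mult.assoc)
  show "((\<lambda>p. ?h p (f t x) - ?h p (g t x)) has_sum nl_remainder a (f t x) - nl_remainder a (g t x)) UNIV"
    if t: "t \<in> {0..T}" for t x
  proof -
    have "cmod (f t x) < 1" "cmod (g t x) < 1"
      using wiener_bound_norm_le[OF f t, of x] wiener_bound_norm_le[OF g t, of x] r by auto
    from has_sum_add[OF nl_remainder_has_sum[OF a this(1)] has_sum_uminusI[OF nl_remainder_has_sum[OF a this(2)]]]
    show ?thesis by simp
  qed
qed

end

section \<open>Plane waves and the perturbed constant\<close>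

lemma has_integral_cis_phase:
  assumes "0 \<le> t"
  shows "((\<lambda>\<tau>. - \<i> * of_real \<sigma> * cis (- \<sigma> * \<tau>)) has_integral (cis (- \<sigma> * t) - 1)) {0..t}"
proof -
  have "((\<lambda>\<tau>. - \<i> * of_real \<sigma> * cis (- \<sigma> * \<tau>)) has_integral (cis (- \<sigma> * t) - cis (- \<sigma> * 0))) {0..t}"
  proof (rule fundamental_theorem_of_calculus[OF assms])
    fix \<tau> :: real
    show "((\<lambda>\<tau>. cis (- \<sigma> * \<tau>)) has_vector_derivative - \<i> * of_real \<sigma> * cis (- \<sigma> * \<tau>)) (at \<tau> within {0..t})"
      unfolding cis_conv_exp
      by (auto intro!: derivative_eq_intros has_vector_derivative_real_field simp: field_simps)
  qed
  then show ?thesis by simp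
qed

lemma norm_cis_phase_le:
  assumes "0 \<le> t"
  shows "cmod (cis (- \<sigma> * t) - 1) \<le> \<bar>\<sigma>\<bar> * t"
  using has_integral_bound[OF _ has_integral_cis_phase[OF assms, of \<sigma>, folded cbox_interval], of "\<bar>\<sigma>\<bar>"] assms
  by (simp add: norm_mult)

lemma power_nl_cis: "power_nl a (cis \<theta>) = cis \<theta>"
  by (simp add: power_nl_def)

lemma power_nl_scale:
  assumes "0 < c"
  shows "power_nl a (of_real c * z) = of_real (c powr a * c) * power_nl a z"
  using assms by (simp add: power_nl_def norm_mult powr_mult mult_ac)

lemma nonlin_eq_power_nl: "nonlin a f = (\<lambda>x. power_nl a (f x))"
  by (simp add: nonlin_def power_nl_def)

section \<open>From Wiener bounds to mild solutions in H^s\<close>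

context wiener_weight
begin

text \<open>Weighted l^1 sequences are weighted l^2 sequences. The constant \<open>B\<close> may
  depend on the weight, and later does depend on N, because the conclusion is membership and not a
  norm bound.\<close>

lemma wiener_bound_in_Hs:
  assumes hs: "\<And>k. (1 + ksq k) powr s \<le> B * (W k)\<^sup>2"
    and f: "wiener_bound r f" and t: "t \<in> {0..T}"
  shows "in_Hs s (f t)"
proof -
  obtain m where "fourier_majorant m f" using f by (rule wiener_boundE)
  note m = fourier_majorantD[OF this]
  have cont: "continuous_on UNIV (f t)" by (rule m(6)[OF t])
  have "f t (x + (2 * pi) *\<^sub>R axis j 1) = f t x" for x j
    using m(5)[OF t, of "x + (2 * pi) *\<^sub>R axis j 1"] m(5)[OF t, of x] unfolding character_periodic
    by (rule has_sum_unique)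
  then have "periodic_torus (f t)" by (simp add: periodic_torus_def)
  moreover have "set_borel_measurable lborel torus_box (f t)"
    using set_integrable_torus_box[OF cont]
    unfolding set_integrable_def set_borel_measurable_def by (rule borel_measurable_integrable)
  moreover have "set_integrable lborel torus_box (\<lambda>x. (cmod (f t x))\<^sup>2)"
    by (intro set_integrable_torus_box continuous_intros cont)
  moreover have "Hs_weight s (f t) summable_on UNIV"
  proof (rule summable_on_comparison_test)
    show "(\<lambda>k. B * (W k * m k)\<^sup>2) summable_on UNIV"
      by (intro summable_on_cmult_right summable_on_square m mult_nonneg_nonneg W_nonneg)
    show "Hs_weight s (f t) k \<le> B * (W k * m k)\<^sup>2" for k
    proof -
      have "Hs_weight s (f t) k \<le> (B * (W k)\<^sup>2) * (m k)\<^sup>2"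
        unfolding Hs_weight_def
        by (intro mult_mono hs power_mono m t order_trans[OF powr_ge_zero hs]) auto
      then show ?thesis by (simp add: power_mult_distrib mult.assoc)
    qed
  qed (simp add: Hs_weight_def)
  ultimately show ?thesis by (simp add: in_Hs_def)
qed

lemma wiener_bound_Hs_continuous:
  assumes hs: "\<And>k. (1 + ksq k) powr s \<le> B * (W k)\<^sup>2"
    and f: "wiener_bound r f" and t: "t \<in> {0..T}"
  shows "((\<lambda>\<tau>. Hs_norm s (f \<tau> - f t)) \<longlongrightarrow> 0) (at t within {0..T})"
proof -
  obtain m where "fourier_majorant m f" using f by (rule wiener_boundE)
  note m = fourier_majorantD[OF this]
  let ?w = "\<lambda>k \<tau>. (1 + ksq k) powr s * (cmod (fcoeff (f \<tau>) k - fcoeff (f t) k))\<^sup>2"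
  have "continuous_on {0..T} (\<lambda>\<tau>. \<Sum>\<^sub>\<infinity>k. ?w k \<tau>)"
  proof (rule continuous_on_infsum)
    show "continuous_on {0..T} (?w k)" for k by (intro continuous_intros m)
    show "(\<lambda>k. (4 * B) * (W k * m k)\<^sup>2) summable_on UNIV"
      by (intro summable_on_cmult_right summable_on_square m mult_nonneg_nonneg W_nonneg)
    show "norm (?w k \<tau>) \<le> (4 * B) * (W k * m k)\<^sup>2" if "\<tau> \<in> {0..T}" for k \<tau>
    proof -
      have "cmod (fcoeff (f \<tau>) k - fcoeff (f t) k) \<le> 2 * m k"
        using norm_triangle_ineq4[of "fcoeff (f \<tau>) k" "fcoeff (f t) k"] m(2)[OF that, of k] m(2)[OF t, of k] by simp
      then have "?w k \<tau> \<le> (B * (W k)\<^sup>2) * (2 * m k)\<^sup>2"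
        by (intro mult_mono hs power_mono order_trans[OF powr_ge_zero hs]) auto
      then show ?thesis by (simp add: power_mult_distrib mult_ac)
    qed
  qed
  then have "continuous_on {0..T} (\<lambda>\<tau>. sqrt (\<Sum>\<^sub>\<infinity>k. ?w k \<tau>))" by (intro continuous_intros)
  then have "((\<lambda>\<tau>. sqrt (\<Sum>\<^sub>\<infinity>k. ?w k \<tau>)) \<longlongrightarrow> sqrt (\<Sum>\<^sub>\<infinity>k. ?w k t)) (at t within {0..T})"
    using t unfolding continuous_on_def by blast
  then have lim: "((\<lambda>\<tau>. sqrt (\<Sum>\<^sub>\<infinity>k. ?w k \<tau>)) \<longlongrightarrow> 0) (at t within {0..T})" by simp
  have eq: "sqrt (\<Sum>\<^sub>\<infinity>k. ?w k \<tau>) = Hs_norm s (f \<tau> - f t)" if "\<tau> \<in> {0..T}" for \<tau>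
    unfolding Hs_norm_def Hs_weight_def fun_diff_def
    using fcoeff_diff[OF m(6)[OF that] m(6)[OF t]] by simp
  show ?thesis
    by (rule Lim_transform_eventually[OF lim]) (use eq in \<open>auto simp: eventually_at_filter\<close>)
qed

lemma nls_solutionI:
  assumes hs: "\<And>k. (1 + ksq k) powr s \<le> B * (W k)\<^sup>2"
    and u: "wiener_bound r u" and n: "wiener_bound q (\<lambda>t. nonlin a (u t))"
    and modes: "\<And>t k. t \<in> {0..T} \<Longrightarrow> fcoeff (u t) k = cis (- t * ksq k) * fcoeff u0 k - \<i> * complex_of_real mu *
      integral {0..t} (\<lambda>\<tau>. cis (- (t - \<tau>) * ksq k) * fcoeff (nonlin a (u \<tau>)) k)"
  shows "nls_solution mu a s T u0 u"
  unfolding nls_solution_def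
proof (intro conjI ballI allI)
  fix t assume t: "t \<in> {0..T}"
  show "in_Hs s (u t)" by (rule wiener_bound_in_Hs[OF hs u t])
  show "((\<lambda>\<tau>. Hs_norm s (u \<tau> - u t)) \<longlongrightarrow> 0) (at t within {0..T})"
    by (rule wiener_bound_Hs_continuous[OF hs u t])
  show "set_integrable lborel torus_box (nonlin a (u t))"
    by (rule set_integrable_torus_box[OF wiener_bound_continuous[OF n t]])
  show "\<exists>I. ((\<lambda>\<tau>. cis (- (t - \<tau>) * ksq k) * fcoeff (nonlin a (u \<tau>)) k) has_integral I) {0..t} \<and>
            fcoeff (u t) k = cis (- t * ksq k) * fcoeff u0 k - \<i> * complex_of_real mu * I" for k
    using integrable_integral[OF duhamel_integrable[OF n t, of k]] modes[OF t, of k] by blast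
qed

text \<open>The modulus of \<open>v\<close> is the constant \<open>A\<close>, so the nonlinearity
  acts as multiplication by \<open>A powr a\<close> and merely shifts the time frequency from
  \<open>ksq l\<close> to \<open>ksq l + mu * A powr a\<close>.\<close>

lemma plane_wave_solution:
  fixes A a mu :: real and l :: "int^'d"
  assumes hs: "\<And>k. (1 + ksq k) powr s \<le> B * (W k)\<^sup>2" and A: "0 < A"
  defines "v \<equiv> \<lambda>t x. of_real A * cis (- (ksq l + mu * A powr a) * t) * character l x"
  shows "wiener_bound (W l * A) v"
    and "nls_solution mu a s T (\<lambda>x. of_real A * character l x) v"
proof -
  let ?\<sigma> = "mu * A powr a"
  have v_nl: "nonlin a (v t) = (\<lambda>x. (of_real (A powr a * A) * cis (- (ksq l + ?\<sigma>) * t)) * character l x)" for t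
    using A by (auto simp: v_def nonlin_def norm_mult mult_ac)
  show v: "wiener_bound (W l * A) v"
    unfolding v_def by (rule wiener_bound_character) (use A in \<open>auto intro!: continuous_intros simp: norm_mult\<close>)
  have n: "wiener_bound (W l * (A powr a * A)) (\<lambda>t. nonlin a (v t))"
    unfolding v_nl by (rule wiener_bound_character) (use A in \<open>auto intro!: continuous_intros simp: norm_mult\<close>)
  show "nls_solution mu a s T (\<lambda>x. of_real A * character l x) v"
  proof (rule nls_solutionI[OF hs v n])
    fix t k assume t: "t \<in> {0..T}"
    show "fcoeff (v t) k = cis (- t * ksq k) * fcoeff (\<lambda>x. of_real A * character l x) k - \<i> * complex_of_real mu *
      integral {0..t} (\<lambda>\<tau>. cis (- (t - \<tau>) * ksq k) * fcoeff (nonlin a (v \<tau>)) k)"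
    proof (cases "k = l")
      case False
      then show ?thesis by (simp add: v_nl, simp add: v_def fcoeff_cmult fcoeff_character)
    next
      case True
      \<comment> \<open>The linear frequency cancels against the propagator; only the slow nonlinear
        phase remains to be integrated.\<close>
      have phase: "cis (- (t - \<tau>) * ksq l) * cis (- (ksq l + ?\<sigma>) * \<tau>) = cis (- t * ksq l) * cis (- ?\<sigma> * \<tau>)" for \<tau>
        by (simp add: cis_mult algebra_simps)
      have fc: "fcoeff (nonlin a (v \<tau>)) l = of_real (A powr a * A) * cis (- (ksq l + ?\<sigma>) * \<tau>)" for \<tau>
        unfolding v_nl fcoeff_cmult fcoeff_character by simp
      have "- \<i> * complex_of_real mu * integral {0..t} (\<lambda>\<tau>. cis (- (t - \<tau>) * ksq l) * fcoeff (nonlin a (v \<tau>)) l)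
        = - \<i> * complex_of_real mu * integral {0..t} (\<lambda>\<tau>. of_real (A powr a * A) * cis (- t * ksq l) * cis (- ?\<sigma> * \<tau>))"
        by (simp only: fc mult.left_commute[of "cis _" "complex_of_real (A powr a * A)"] phase mult.assoc)
      also have "\<dots> = of_real A * cis (- t * ksq l) * integral {0..t} (\<lambda>\<tau>. - \<i> * of_real ?\<sigma> * cis (- ?\<sigma> * \<tau>))"
        by (simp add: mult_ac)
      also have "\<dots> = of_real A * cis (- t * ksq l) * (cis (- ?\<sigma> * t) - 1)"
        using t by (subst integral_unique[OF has_integral_cis_phase]) auto
      also have "\<dots> = of_real A * cis (- (ksq l + ?\<sigma>) * t) - of_real A * cis (- t * ksq l)"
        by (simp add: algebra_simps cis_mult)
      finally show ?thesis unfolding True v_def fcoeff_cmult fcoeff_character by (simp add: algebra_simps)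
    qed
  qed
qed

end

text \<open>\<delta> is the background, \<kappa> the amplitude of the wave relative to it,
  \<open>r\<close> the radius on which the nonlinearity is expanded around 1. The bound r <= 1/2
  puts the expansion inside its disc of convergence; \<open>lipschitz_const * r \<le> 1\<close> and
  1 + a <= 2 give the force Lipschitz constant 3; the third condition keeps background and wave
  within \<open>r\<close> of 1; and 3 * 1/6 = 1/2 is the contraction factor.\<close>

locale perturbed_wave = wiener_weight T W
  for T :: real and W :: "int^'d \<Rightarrow> real" +
  fixes a mu \<delta> \<kappa> r :: real and l :: "int^'d"
  assumes a: "0 \<le> a" "a \<le> 1" and mu: "\<bar>mu\<bar> = 1" and \<delta>: "0 < \<delta>" and \<kappa>: "0 \<le> \<kappa>" and l: "l \<noteq> 0"
    and r: "r \<le> 1/2" "lipschitz_const * r \<le> 1" "\<delta> powr a * T + 2 * (W l * \<kappa>) \<le> r"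
    and \<eta>: "\<delta> powr a * T \<le> 1/6"
begin

text \<open>With \<open>u = \<delta> (background + y)\<close>, the Duhamel equation for \<open>u\<close> becomes \<open>y = picard y\<close>.\<close>
definition background :: "real \<Rightarrow> complex" where
  "background t = cis (- (mu * \<delta> powr a) * t)"

definition incident :: "real \<Rightarrow> real^'d \<Rightarrow> complex" where
  "incident t x = of_real \<kappa> * cis (- ksq l * t) * character l x"

text \<open>The background solves the rescaled equation by itself and its nonlinear term is
  \<open>background t\<close> again, as its modulus is 1. Subtracting that term leaves what drives
  the wave.\<close>

definition force :: "(real \<Rightarrow> real^'d \<Rightarrow> complex) \<Rightarrow> real \<Rightarrow> real^'d \<Rightarrow> complex" where
  "force y t x = power_nl a (background t + y t x) - background t"

definition picard :: "(real \<Rightarrow> real^'d \<Rightarrow> complex) \<Rightarrow> real \<Rightarrow> real^'d \<Rightarrow> complex" where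
  "picard y t x = incident t x - \<i> * of_real (mu * \<delta> powr a) * duhamel (force y) t x"

lemma W\<kappa>_nonneg: "0 \<le> W l * \<kappa>" using W_nonneg \<kappa> by simp

lemma eta_nonneg: "0 \<le> \<delta> powr a * T" using T_nonneg by simp

lemma wiener_bound_incident: "wiener_bound (W l * \<kappa>) incident"
  unfolding incident_def
  by (rule wiener_bound_character) (use \<kappa> in \<open>auto intro!: continuous_intros simp: norm_mult\<close>)

text \<open>The power series is centred at the fixed point 1, not at the rotating background; over
  the time \<open>T\<close> the background moves away from 1 by at most
  \<open>\<delta> powr a * T\<close>.\<close>

lemma wiener_bound_shifted:
  assumes "wiener_bound (2 * (W l * \<kappa>)) y"
  shows "wiener_bound r (\<lambda>t x. (background t - 1) + y t x)"
proof -
  have "wiener_bound (\<delta> powr a * T) (\<lambda>t x. background t - 1)"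
  proof (rule wiener_bound_const)
    show "continuous_on {0..T} (\<lambda>t. background t - 1)" unfolding background_def by (intro continuous_intros)
    show "cmod (background t - 1) \<le> \<delta> powr a * T" if "t \<in> {0..T}" for t
    proof -
      have "cmod (background t - 1) \<le> \<bar>mu * \<delta> powr a\<bar> * t"
        unfolding background_def by (rule norm_cis_phase_le) (use that in simp)
      also have "\<dots> \<le> \<delta> powr a * T" using mu that by (simp add: abs_mult mult_left_mono)
      finally show ?thesis .
    qed
  qed
  from wiener_bound_add[OF this assms] show ?thesis by (rule wiener_bound_mono) (rule r)
qed

lemma force_diff_eq:
  "force y t x - force z t x = of_real (1 + a / 2) * (y t x - z t x) + of_real (a / 2) * cnj (y t x - z t x)
     + (nl_remainder a ((background t - 1) + y t x) - nl_remainder a ((background t - 1) + z t x))"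
  unfolding force_def nl_remainder_def by (simp add: algebra_simps)

lemma force_0: "force (\<lambda>t x. 0) t x = 0"
  by (simp add: force_def background_def power_nl_cis)

lemma wiener_bound_linear_part:
  assumes "wiener_bound d h"
  shows "wiener_bound ((1 + a) * d) (\<lambda>t x. of_real (1 + a / 2) * h t x + of_real (a / 2) * cnj (h t x))"
proof -
  have "wiener_bound (cmod (of_real (1 + a / 2)) * d + cmod (of_real (a / 2)) * d)
    (\<lambda>t x. of_real (1 + a / 2) * h t x + of_real (a / 2) * cnj (h t x))"
    by (intro wiener_bound_add wiener_bound_scale wiener_bound_cnj assms)
  moreover have "cmod (of_real (1 + a / 2)) * d + cmod (of_real (a / 2)) * d = (1 + a) * d"
    using a unfolding norm_of_real by (simp add: algebra_simps)
  ultimately show ?thesis by (simp only:)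
qed

lemma wiener_bound_force_diff:
  assumes y: "wiener_bound (2 * (W l * \<kappa>)) y" and z: "wiener_bound (2 * (W l * \<kappa>)) z"
    and d: "wiener_bound d (\<lambda>t x. y t x - z t x)"
  shows "wiener_bound (3 * d) (\<lambda>t x. force y t x - force z t x)"
proof -
  have "wiener_bound (lipschitz_const * r * d)
    (\<lambda>t x. nl_remainder a ((background t - 1) + y t x) - nl_remainder a ((background t - 1) + z t x))"
    by (rule wiener_bound_nl_remainder_diff[OF a r(1) wiener_bound_shifted[OF y] wiener_bound_shifted[OF z]])
       (use d in simp)
  from wiener_bound_add[OF wiener_bound_linear_part[OF d] this]
  have "wiener_bound ((1 + a) * d + lipschitz_const * r * d) (\<lambda>t x. force y t x - force z t x)"
    unfolding force_diff_eq .
  \<comment> \<open>The linear part contributes (1 + a/2) + a/2 <= 2 and the remainder at most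
    1.\<close>
  moreover have "(1 + a) * d + lipschitz_const * r * d \<le> 3 * d"
  proof -
    have "(1 + a + lipschitz_const * r) * d \<le> 3 * d"
      using a r(2) wiener_bound_nonneg[OF d] by (intro mult_right_mono) auto
    then show ?thesis by (simp add: algebra_simps)
  qed
  ultimately show ?thesis by (rule wiener_bound_mono)
qed

lemma wiener_bound_zero: "wiener_bound (2 * (W l * \<kappa>)) (\<lambda>t x. 0)"
  by (rule wiener_bound_mono[OF wiener_bound_0]) (use W\<kappa>_nonneg in simp)

lemma wiener_bound_force:
  assumes y: "wiener_bound (2 * (W l * \<kappa>)) y"
  shows "wiener_bound (6 * (W l * \<kappa>)) (force y)"
  using wiener_bound_force_diff[OF y wiener_bound_zero, of "2 * (W l * \<kappa>)"] y by (simp add: force_0)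

lemma wiener_bound_duhamel_scaled:
  assumes "wiener_bound d h"
  shows "wiener_bound (\<delta> powr a * T * d) (\<lambda>t x. - \<i> * of_real (mu * \<delta> powr a) * duhamel h t x)"
  using wiener_bound_scale[OF wiener_bound_duhamel(1)[OF assms], of "- \<i> * of_real (mu * \<delta> powr a)"] mu
  by (simp add: norm_mult abs_mult mult.assoc)

lemma wiener_bound_picard_diff:
  assumes y: "wiener_bound (2 * (W l * \<kappa>)) y" and z: "wiener_bound (2 * (W l * \<kappa>)) z"
    and d: "wiener_bound d (\<lambda>t x. y t x - z t x)"
  shows "wiener_bound (d / 2) (\<lambda>t x. picard y t x - picard z t x)"
proof -
  have "wiener_bound (\<delta> powr a * T * (3 * d))
    (\<lambda>t x. - \<i> * of_real (mu * \<delta> powr a) * duhamel (\<lambda>t x. force y t x - force z t x) t x)"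
    by (intro wiener_bound_duhamel_scaled wiener_bound_force_diff y z d)
  then have "wiener_bound (\<delta> powr a * T * (3 * d)) (\<lambda>t x. picard y t x - picard z t x)"
    by (rule wiener_bound_cong)
       (simp add: picard_def duhamel_diff[OF wiener_bound_force[OF y] wiener_bound_force[OF z], symmetric] algebra_simps)
  moreover have "\<delta> powr a * T * (3 * d) \<le> 1/6 * (3 * d)"
    using \<eta> wiener_bound_nonneg[OF d] by (intro mult_right_mono) auto
  ultimately show ?thesis by (elim wiener_bound_mono) simp
qed

section \<open>Picard iteration and its limit\<close>

fun iterate :: "nat \<Rightarrow> real \<Rightarrow> real^'d \<Rightarrow> complex" where
  "iterate 0 = (\<lambda>t x. 0)"
| "iterate (Suc n) = picard (iterate n)"

text \<open>The two bounds need a joint induction: the contraction estimate is available only inside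
  the ball of radius \<open>2 * (W l * \<kappa>)\<close>, and it is the geometric sum of the earlier
  steps that keeps the iterates in this ball.\<close>

lemma iterate_bounds:
  "wiener_bound (2 * (W l * \<kappa>) * (1 - (1/2) ^ n)) (iterate n) \<and>
   wiener_bound ((W l * \<kappa>) * (1/2) ^ n) (\<lambda>t x. iterate (Suc n) t x - iterate n t x)"
proof (induction n)
  case 0
  have "duhamel (force (\<lambda>t x. 0)) t x = 0" for t x
    by (simp add: duhamel_def force_0 fcoeff_def)
  then have "picard (\<lambda>t x. 0) = incident"
    by (intro ext) (simp add: picard_def)
  then show ?case using wiener_bound_0 wiener_bound_incident by simp
next
  case (Suc n)
  have le: "2 * (W l * \<kappa>) * (1 - (1/2) ^ n) \<le> 2 * (W l * \<kappa>)" for n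
    using W\<kappa>_nonneg by (intro mult_left_le) auto
  have "wiener_bound (2 * (W l * \<kappa>) * (1 - (1/2) ^ n) + (W l * \<kappa>) * (1/2) ^ n)
    (\<lambda>t x. iterate n t x + (iterate (Suc n) t x - iterate n t x))"
    using Suc by (intro wiener_bound_add) auto
  moreover have "2 * (W l * \<kappa>) * (1 - (1/2) ^ n) + (W l * \<kappa>) * (1/2) ^ n = 2 * (W l * \<kappa>) * (1 - (1/2) ^ Suc n)"
    by (simp add: algebra_simps)
  ultimately have 1: "wiener_bound (2 * (W l * \<kappa>) * (1 - (1/2) ^ Suc n)) (iterate (Suc n))"
    by (simp del: iterate.simps)
  have "wiener_bound ((W l * \<kappa>) * (1/2) ^ n / 2) (\<lambda>t x. picard (iterate (Suc n)) t x - picard (iterate n) t x)"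
    by (rule wiener_bound_picard_diff[OF wiener_bound_mono[OF 1 le] wiener_bound_mono[OF conjunct1[OF Suc] le] conjunct2[OF Suc]])
  then have "wiener_bound ((W l * \<kappa>) * (1/2) ^ Suc n) (\<lambda>t x. iterate (Suc (Suc n)) t x - iterate (Suc n) t x)"
    by simp
  with 1 show ?case by blast
qed

lemma wiener_bound_iterate: "wiener_bound (2 * (W l * \<kappa>)) (iterate n)"
  by (rule wiener_bound_mono[OF conjunct1[OF iterate_bounds]])
     (use W\<kappa>_nonneg in \<open>intro mult_left_le, auto\<close>)

definition wave :: "real \<Rightarrow> real^'d \<Rightarrow> complex" where
  "wave t x = lim (\<lambda>n. iterate n t x)"

lemma norm_iterate_step_le:
  "t \<in> {0..T} \<Longrightarrow> cmod (iterate (Suc n) t x - iterate n t x) \<le> (W l * \<kappa>) * (1/2) ^ n"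
  using wiener_bound_norm_le[OF conjunct2[OF iterate_bounds]] by blast

lemma iterate_tendsto_wave:
  assumes t: "t \<in> {0..T}"
  shows "(\<lambda>n. iterate n t x) \<longlonglongrightarrow> wave t x"
proof -
  have "summable (\<lambda>n. iterate (Suc n) t x - iterate n t x)"
    by (rule summable_comparison_test'[where g="\<lambda>n. (W l * \<kappa>) * (1/2) ^ n" and N=0])
       (use norm_iterate_step_le[OF t] in \<open>auto intro!: summable_mult summable_geometric simp del: iterate.simps\<close>)
  then have "convergent (\<lambda>n. \<Sum>i<n. iterate (Suc i) t x - iterate i t x)"
    by (simp add: summable_iff_convergent del: iterate.simps)
  then have "convergent (\<lambda>n. iterate n t x)"
    unfolding sum_lessThan_telescope[of "\<lambda>i. iterate i t x"] by simp
  then show ?thesis unfolding wave_def by (simp add: convergent_LIMSEQ_iff)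
qed

text \<open>The limit is taken pointwise; writing the tail as a telescoping series lifts the
  geometric bounds on the steps to a Wiener bound on the limit.\<close>

lemma wiener_bound_wave_diff: "wiener_bound (2 * (W l * \<kappa>) * (1/2) ^ N) (\<lambda>t x. wave t x - iterate N t x)"
proof (rule wiener_bound_infsum)
  let ?f = "\<lambda>n t x. iterate (Suc (n + N)) t x - iterate (n + N) t x"
  show "wiener_bound ((W l * \<kappa>) * (1/2) ^ (n + N)) (?f n)" for n
    using iterate_bounds by blast
  have g: "(\<lambda>n. (W l * \<kappa>) * (1/2) ^ (n + N)) sums ((W l * \<kappa>) * (1/2) ^ N * (1 / (1 - 1/2)))"
    using sums_mult[OF geometric_sums[of "1/2::real"], of "(W l * \<kappa>) * (1/2) ^ N"] by (simp add: power_add mult_ac)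
  then have "(\<lambda>n. (W l * \<kappa>) * (1/2) ^ (n + N)) sums (2 * (W l * \<kappa>) * (1/2) ^ N)"
    by (simp add: mult_ac)
  then show "((\<lambda>n. (W l * \<kappa>) * (1/2) ^ (n + N)) has_sum 2 * (W l * \<kappa>) * (1/2) ^ N) UNIV"
    by (rule sums_nonneg_imp_has_sum) (intro mult_nonneg_nonneg W\<kappa>_nonneg, simp)
  fix t x assume t: "t \<in> {0..T}"
  have "summable (\<lambda>n. norm (?f n t x))"
    by (rule summable_comparison_test'[OF sums_summable[OF g], where N=0])
       (use norm_iterate_step_le[OF t] in \<open>simp del: iterate.simps\<close>)
  moreover have "(\<lambda>n. ?f n t x) sums (wave t x - iterate N t x)"
    using telescope_sums[OF LIMSEQ_ignore_initial_segment[OF iterate_tendsto_wave[OF t], of N]] by simp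
  ultimately show "((\<lambda>n. ?f n t x) has_sum wave t x - iterate N t x) UNIV"
    by (rule norm_summable_imp_has_sum)
qed

lemma wiener_bound_wave: "wiener_bound (2 * (W l * \<kappa>)) wave"
  using wiener_bound_wave_diff[of 0] by simp

text \<open>Both \<open>picard wave\<close> and \<open>wave\<close> are compared with
  \<open>iterate (Suc n)\<close>. Each distance is at most half of
  \<open>2 * (W l * \<kappa>) * (1/2) ^ n\<close>, so the two sides agree up to an arbitrarily small
  bound.\<close>

lemma wave_fixpoint:
  assumes t: "t \<in> {0..T}"
  shows "wave t x = picard wave t x"
proof -
  have "wiener_bound e (\<lambda>t x. picard wave t x - wave t x)" if "e > 0" for e
  proof -
    have "wiener_bound (2 * (W l * \<kappa>) * (1/2) ^ n) (\<lambda>t x. picard wave t x - wave t x)" for n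
    proof -
      have "wiener_bound ((2 * (W l * \<kappa>) * (1/2) ^ n) / 2) (\<lambda>t x. picard wave t x - picard (iterate n) t x)"
        by (rule wiener_bound_picard_diff[OF wiener_bound_wave wiener_bound_iterate wiener_bound_wave_diff])
      from wiener_bound_diff[OF this wiener_bound_wave_diff[of "Suc n"]]
      show ?thesis by (simp add: mult_ac)
    qed
    moreover have "(\<lambda>n. 2 * (W l * \<kappa>) * (1/2) ^ n) \<longlonglongrightarrow> 2 * (W l * \<kappa>) * 0"
      by (intro tendsto_intros LIMSEQ_power_zero) auto
    then have "\<forall>\<^sub>F n in sequentially. 2 * (W l * \<kappa>) * (1/2) ^ n < e"
      using that by (intro order_tendstoD) auto
    then obtain n where "2 * (W l * \<kappa>) * (1/2) ^ n < e"
      by (auto simp: eventually_sequentially)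
    ultimately show ?thesis using wiener_bound_mono less_imp_le by blast
  qed
  from wiener_bound_eq_0[OF this t, of x] show ?thesis by simp
qed

lemma fcoeff_incident: "fcoeff (incident t) k = (if k = l then of_real \<kappa> * cis (- ksq l * t) else 0)"
  unfolding incident_def by (subst fcoeff_cmult) (simp add: fcoeff_character)

lemma fcoeff_wave:
  assumes t: "t \<in> {0..T}"
  shows "fcoeff (wave t) k = fcoeff (incident t) k - \<i> * of_real (mu * \<delta> powr a) *
    integral {0..t} (\<lambda>\<tau>. cis (- (t - \<tau>) * ksq k) * fcoeff (force wave \<tau>) k)"
proof -
  note fw = wiener_bound_force[OF wiener_bound_wave]
  let ?g = "\<lambda>x. \<i> * of_real (mu * \<delta> powr a) * duhamel (force wave) t x"
  have w: "wave t = (\<lambda>x. incident t x - ?g x)"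
    using wave_fixpoint[OF t] by (auto simp: picard_def)
  have "fcoeff (wave t) k = fcoeff (incident t) k - fcoeff ?g k"
    unfolding w by (rule fcoeff_diff[OF wiener_bound_continuous[OF wiener_bound_incident t]
        continuous_on_mult_left[OF wiener_bound_continuous[OF wiener_bound_duhamel(1)[OF fw] t]]])
  then show ?thesis by (simp only: fcoeff_cmult wiener_bound_duhamel(2)[OF fw t])
qed

section \<open>The solution carried by the wave\<close>

definition solution :: "real \<Rightarrow> real^'d \<Rightarrow> complex" where
  "solution t x = of_real \<delta> * (background t + wave t x)"

lemma continuous_background [continuous_intros]: "continuous_on S background"
  unfolding background_def by (intro continuous_intros)

lemma wiener_bound_background: "wiener_bound 1 (\<lambda>t x. background t)"
  by (rule wiener_bound_const) (auto intro!: continuous_intros simp: background_def)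

lemma wiener_bound_solution: "wiener_bound (\<delta> * (1 + 2 * (W l * \<kappa>))) solution"
  unfolding solution_def
  using wiener_bound_scale[OF wiener_bound_add[OF wiener_bound_background wiener_bound_wave], of "of_real \<delta>"] \<delta>
  by simp

lemma nonlin_solution:
  "nonlin a (solution t) = (\<lambda>x. of_real (\<delta> powr a * \<delta>) * (background t + force wave t x))"
  unfolding nonlin_eq_power_nl solution_def power_nl_scale[OF \<delta>] by (simp add: force_def)

lemma solution_is_nls_solution:
  assumes hs: "\<And>k. (1 + ksq k) powr s \<le> B * (W k)\<^sup>2"
  shows "nls_solution mu a s T (\<lambda>x. of_real \<delta> * (1 + of_real \<kappa> * character l x)) solution"
proof (rule nls_solutionI[OF hs wiener_bound_solution])
  note fw = wiener_bound_force[OF wiener_bound_wave]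
  show "wiener_bound (cmod (of_real (\<delta> powr a * \<delta>)) * (1 + 6 * (W l * \<kappa>))) (\<lambda>t. nonlin a (solution t))"
    unfolding nonlin_solution by (intro wiener_bound_scale wiener_bound_add wiener_bound_background fw)
  fix t k assume t: "t \<in> {0..T}"
  let ?J = "integral {0..t} (\<lambda>\<tau>. cis (- (t - \<tau>) * ksq k) * fcoeff (force wave \<tau>) k)"
  let ?b = "if k = 0 then 1 else 0 :: complex"
  have bg: "((\<lambda>\<tau>. - \<i> * of_real (mu * \<delta> powr a) * background \<tau>) has_integral (background t - 1)) {0..t}"
    unfolding background_def by (rule has_integral_cis_phase) (use t in simp)
  have J: "((\<lambda>\<tau>. cis (- (t - \<tau>) * ksq k) * fcoeff (force wave \<tau>) k) has_integral ?J) {0..t}"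
    by (rule integrable_integral[OF duhamel_integrable[OF fw t]])
  \<comment> \<open>The Duhamel integrand splits into a background and a wave part with known
    integrals. The background occupies only mode 0, where \<open>ksq 0 = 0\<close> makes the
    propagator trivial.\<close>
  have eq: "- \<i> * of_real mu * (cis (- (t - \<tau>) * ksq k) * fcoeff (nonlin a (solution \<tau>)) k)
      = of_real \<delta> * (?b * (- \<i> * of_real (mu * \<delta> powr a) * background \<tau>)
        + - \<i> * of_real (mu * \<delta> powr a) * (cis (- (t - \<tau>) * ksq k) * fcoeff (force wave \<tau>) k))"
    if "\<tau> \<in> {0..t}" for \<tau>
  proof -
    have "\<tau> \<in> {0..T}" using that t by simp
    then have "fcoeff (nonlin a (solution \<tau>)) k
       = of_real (\<delta> powr a * \<delta>) * ((if k = 0 then background \<tau> else 0) + fcoeff (force wave \<tau>) k)"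
      unfolding nonlin_solution fcoeff_cmult
      by (subst fcoeff_const_add[OF wiener_bound_continuous[OF fw]]) auto
    then show ?thesis by (simp add: ksq_def algebra_simps)
  qed
  have "((\<lambda>\<tau>. - \<i> * of_real mu * (cis (- (t - \<tau>) * ksq k) * fcoeff (nonlin a (solution \<tau>)) k))
    has_integral of_real \<delta> * (?b * (background t - 1) + - \<i> * of_real (mu * \<delta> powr a) * ?J)) {0..t}"
    by (rule has_integral_eq[OF eq[symmetric]]) (assumption, intro has_integral_mult_right has_integral_add bg J)
  then have 1: "- \<i> * of_real mu * integral {0..t} (\<lambda>\<tau>. cis (- (t - \<tau>) * ksq k) * fcoeff (nonlin a (solution \<tau>)) k)
    = of_real \<delta> * (?b * (background t - 1) + - \<i> * of_real (mu * \<delta> powr a) * ?J)"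
    by (subst integral_mult_right[symmetric]) (rule integral_unique)
  have 2: "fcoeff (solution t) k = of_real \<delta> * (?b * background t + fcoeff (wave t) k)"
    unfolding solution_def fcoeff_cmult
    by (subst fcoeff_const_add[OF wiener_bound_continuous[OF wiener_bound_wave t]]) simp
  have 3: "cis (- t * ksq k) * fcoeff (\<lambda>x. of_real \<delta> * (1 + of_real \<kappa> * character l x)) k
    = of_real \<delta> * (?b + fcoeff (incident t) k)"
    unfolding fcoeff_cmult fcoeff_incident
    by (subst fcoeff_const_add) (auto intro!: continuous_intros simp: fcoeff_cmult fcoeff_character ksq_def algebra_simps)
  have "fcoeff (solution t) k = cis (- t * ksq k) * fcoeff (\<lambda>x. of_real \<delta> * (1 + of_real \<kappa> * character l x)) k
    + - \<i> * of_real mu * integral {0..t} (\<lambda>\<tau>. cis (- (t - \<tau>) * ksq k) * fcoeff (nonlin a (solution \<tau>)) k)"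
    unfolding 1 2 3 fcoeff_wave[OF t] by (simp only: ring_distribs minus_mult_left[symmetric] diff_conv_add_uminus) (simp add: algebra_simps)
  then show "fcoeff (solution t) k = cis (- t * ksq k) * fcoeff (\<lambda>x. of_real \<delta> * (1 + of_real \<kappa> * character l x)) k
    - \<i> * complex_of_real mu * integral {0..t} (\<lambda>\<tau>. cis (- (t - \<tau>) * ksq k) * fcoeff (nonlin a (solution \<tau>)) k)"
    by (simp only: diff_conv_add_uminus mult_minus_left)
qed

text \<open>To first order the force on mode \<open>l\<close> is 1 + a/2 times the incident wave. It
  oscillates exactly like the free propagator, so this resonant forcing accumulates over time: its
  Duhamel integral has modulus at least \<kappa> T. The hypothesis \<open>small\<close> holds all
  other contributions to half of that.\<close>

lemma wave_phase_shift:
  assumes small: "W l * (12 * (\<delta> powr a * T) + 2 * (lipschitz_const * r)) \<le> 1/2"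
  shows "\<delta> powr a * T * \<kappa> / 2 \<le> cmod (fcoeff (wave T) l - of_real \<kappa> * cis (- ksq l * T))"
proof -
  have T: "T \<in> {0..T}" using T_nonneg by simp
  note fw = wiener_bound_force[OF wiener_bound_wave]
  let ?h = "\<lambda>t x. wave t x - incident t x"
  define Q where "Q = (\<lambda>t x. force wave t x - (of_real (1 + a / 2) * incident t x + of_real (a / 2) * cnj (incident t x)))"
  \<comment> \<open>Here 12 = 2 * 6 comes from 1 + a <= 2 and the bound
    \<open>6 * (W l * \<kappa>)\<close> on the force, applied to the linear part of
    \<open>wave - incident\<close>; the other term is the remainder on a wave of size
    \<open>2 * (W l * \<kappa>)\<close>.\<close>
  define q where "q = 12 * (\<delta> powr a * T) + 2 * (lipschitz_const * r)"
  have h: "wiener_bound (\<delta> powr a * T * (6 * (W l * \<kappa>))) ?h"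
    by (rule wiener_bound_cong[OF wiener_bound_duhamel_scaled[OF fw]])
       (use wave_fixpoint in \<open>simp add: picard_def\<close>)
  have "wiener_bound ((1 + a) * (\<delta> powr a * T * (6 * (W l * \<kappa>))) + lipschitz_const * r * (2 * (W l * \<kappa>)))
    (\<lambda>t x. (of_real (1 + a / 2) * ?h t x + of_real (a / 2) * cnj (?h t x)) +
      (nl_remainder a ((background t - 1) + wave t x) - nl_remainder a ((background t - 1) + 0)))"
    by (intro wiener_bound_add wiener_bound_linear_part h
        wiener_bound_nl_remainder_diff[OF a r(1) wiener_bound_shifted[OF wiener_bound_wave] wiener_bound_shifted[OF wiener_bound_zero]])
       (use wiener_bound_wave in simp)
  then have "wiener_bound ((1 + a) * (\<delta> powr a * T * (6 * (W l * \<kappa>))) + lipschitz_const * r * (2 * (W l * \<kappa>))) Q"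
  proof (rule wiener_bound_cong)
    fix t x
    show "(of_real (1 + a / 2) * ?h t x + of_real (a / 2) * cnj (?h t x)) +
      (nl_remainder a ((background t - 1) + wave t x) - nl_remainder a ((background t - 1) + 0)) = Q t x"
      using force_diff_eq[of wave t x "\<lambda>t x. 0"] unfolding Q_def force_0 by (simp add: algebra_simps)
  qed
  moreover have "(1 + a) * (\<delta> powr a * T * (6 * (W l * \<kappa>))) + lipschitz_const * r * (2 * (W l * \<kappa>)) \<le> q * (W l * \<kappa>)"
  proof -
    have "(1 + a) * (\<delta> powr a * T * (6 * (W l * \<kappa>))) \<le> 2 * (\<delta> powr a * T * (6 * (W l * \<kappa>)))"
      by (intro mult_right_mono mult_nonneg_nonneg[OF eta_nonneg]) (use a W\<kappa>_nonneg in auto)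
    then show ?thesis by (simp add: q_def algebra_simps)
  qed
  ultimately have Q: "wiener_bound (q * (W l * \<kappa>)) Q" by (rule wiener_bound_mono)
  \<comment> \<open>The linearisation also contains the conjugate of the incident wave. It sits in
    mode \<open>- l\<close> and is therefore invisible in mode \<open>l\<close>.\<close>
  have "l \<noteq> - l"
  proof
    assume "l = - l"
    then have "l $ i = - l $ i" for i by (metis vector_uminus_component)
    then have "l = 0" by (simp add: vec_eq_iff)
    with l show False by simp
  qed
  have coeff: "fcoeff (force wave \<tau>) l = of_real ((1 + a / 2) * \<kappa>) * cis (- ksq l * \<tau>) + fcoeff (Q \<tau>) l"
    if \<tau>: "\<tau> \<in> {0..T}" for \<tau>
  proof -
    have "fcoeff (force wave \<tau>) l = fcoeff (\<lambda>x. (of_real (1 + a / 2) * incident \<tau> x + of_real (a / 2) * cnj (incident \<tau> x)) + Q \<tau> x) l"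
      by (simp add: Q_def)
    also have "\<dots> = of_real (1 + a / 2) * fcoeff (incident \<tau>) l + fcoeff (\<lambda>x. of_real (a / 2) * cnj (incident \<tau> x)) l + fcoeff (Q \<tau>) l"
      by (simp only: fcoeff_add fcoeff_cmult continuous_intros wiener_bound_continuous[OF wiener_bound_incident \<tau>]
          wiener_bound_continuous[OF Q \<tau>])
    also have "(\<lambda>x. of_real (a / 2) * cnj (incident \<tau> x)) = (\<lambda>x. (of_real (a / 2 * \<kappa>) * cis (ksq l * \<tau>)) * character (- l) x)"
      by (auto simp: incident_def cis_cnj character_uminus mult_ac)
    also have "fcoeff \<dots> l = 0"
      unfolding fcoeff_cmult using \<open>l \<noteq> - l\<close> by (simp add: fcoeff_character)
    finally show ?thesis by (simp add: fcoeff_incident)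
  qed
  let ?J = "\<lambda>g. integral {0..T} (\<lambda>\<tau>. cis (- (T - \<tau>) * ksq l) * fcoeff (g \<tau>) l)"
  have "?J (force wave) = integral {0..T} (\<lambda>\<tau>. of_real ((1 + a / 2) * \<kappa>) * cis (- ksq l * T) + cis (- (T - \<tau>) * ksq l) * fcoeff (Q \<tau>) l)"
  proof (rule integral_cong)
    fix \<tau> assume "\<tau> \<in> {0..T}"
    moreover have "cis (- (T - \<tau>) * ksq l) * cis (- ksq l * \<tau>) = cis (- ksq l * T)"
      by (simp add: cis_mult algebra_simps)
    ultimately show "cis (- (T - \<tau>) * ksq l) * fcoeff (force wave \<tau>) l
      = of_real ((1 + a / 2) * \<kappa>) * cis (- ksq l * T) + cis (- (T - \<tau>) * ksq l) * fcoeff (Q \<tau>) l"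
      by (simp only: coeff distrib_left mult.left_commute[of "cis (- (T - \<tau>) * ksq l)"])
  qed
  also have "\<dots> = of_real ((1 + a / 2) * \<kappa> * T) * cis (- ksq l * T) + ?J Q"
    using T_nonneg by (subst integral_add[OF integrable_const_ivl duhamel_integrable[OF Q T]])
      (simp add: scaleR_conv_of_real mult_ac)
  finally have J: "?J (force wave) = of_real ((1 + a / 2) * \<kappa> * T) * cis (- ksq l * T) + ?J Q" .
  \<comment> \<open>A single coefficient is estimated by the full Wiener bound, which loses a factor
    \<open>W l\<close>; hence the \<open>W l\<close> in the hypothesis \<open>small\<close>.\<close>
  have "cmod (?J Q) \<le> T * (q * (W l * \<kappa>))"
    by (rule norm_duhamel_integral_le[OF Q T]) (rule wiener_bound_fcoeff_le[OF Q], simp)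
  also have "\<dots> = T * \<kappa> * (W l * q)" by (simp add: mult_ac)
  also have "\<dots> \<le> T * \<kappa> * (1/2)" using small \<kappa> T_nonneg unfolding q_def by (intro mult_left_mono) auto
  finally have JQ: "cmod (?J Q) \<le> \<kappa> * T / 2" by (simp add: mult_ac)
  have "cmod (of_real ((1 + a / 2) * \<kappa> * T) * cis (- ksq l * T)) = (1 + a / 2) * \<kappa> * T"
    unfolding norm_mult norm_of_real norm_cis using a \<kappa> T_nonneg by simp
  moreover have "\<kappa> * T \<le> (1 + a / 2) * \<kappa> * T"
    using mult_right_mono[of 1 "1 + a / 2" "\<kappa> * T"] a \<kappa> T_nonneg by (simp add: mult_ac)
  ultimately have "\<kappa> * T / 2 \<le> cmod (?J (force wave))"
    unfolding J using norm_diff_ineq[of "of_real ((1 + a / 2) * \<kappa> * T) * cis (- ksq l * T)" "?J Q"] JQ by linarith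
  then have "\<delta> powr a * (\<kappa> * T / 2) \<le> \<delta> powr a * cmod (?J (force wave))"
    by (rule mult_left_mono) simp
  also have "\<dots> = cmod (fcoeff (wave T) l - of_real \<kappa> * cis (- ksq l * T))"
    unfolding fcoeff_wave[OF T] fcoeff_incident using mu by (simp add: norm_mult abs_mult)
  finally show ?thesis by (simp add: mult_ac)
qed

text \<open>The plane wave without background has a nonlinear phase too, but of size \<kappa>^a
  \<delta>^a T. With \<kappa>^a <= 1/4 it uses up half of the shift 1/2 from
  \<open>wave_phase_shift\<close>, and 1/4 is left.\<close>

lemma solution_mode_gap:
  assumes small: "W l * (12 * (\<delta> powr a * T) + 2 * (lipschitz_const * r)) \<le> 1/2"
    and \<kappa>_small: "\<kappa> powr a \<le> 1/4"
  shows "\<delta> * \<kappa> * (\<delta> powr a * T) / 4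
    \<le> cmod (fcoeff (solution T) l - of_real (\<delta> * \<kappa>) * cis (- (ksq l + mu * (\<delta> * \<kappa>) powr a) * T))"
proof -
  let ?e = "cis (- ksq l * T)" and ?\<sigma> = "mu * (\<delta> * \<kappa>) powr a"
  let ?X = "of_real \<delta> * (fcoeff (wave T) l - of_real \<kappa> * ?e)"
  let ?Y = "of_real (\<delta> * \<kappa>) * ?e * (cis (- ?\<sigma> * T) - 1)"
  have "fcoeff (solution T) l = of_real \<delta> * fcoeff (wave T) l"
    unfolding solution_def fcoeff_cmult
    by (subst fcoeff_const_add[OF wiener_bound_continuous[OF wiener_bound_wave]]) (use l T_nonneg in auto)
  moreover have "cis (- (ksq l + ?\<sigma>) * T) = ?e * cis (- ?\<sigma> * T)"
    by (simp add: cis_mult algebra_simps)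
  ultimately have eq: "fcoeff (solution T) l - of_real (\<delta> * \<kappa>) * cis (- (ksq l + ?\<sigma>) * T) = ?X - ?Y"
    by (simp add: algebra_simps)
  have "\<delta> * (\<delta> powr a * T * \<kappa> / 2) \<le> \<delta> * cmod (fcoeff (wave T) l - of_real \<kappa> * ?e)"
    using wave_phase_shift[OF small] \<delta> by (intro mult_left_mono) auto
  also have "\<dots> = cmod ?X" using \<delta> by (simp add: norm_mult)
  finally have X: "\<delta> * (\<delta> powr a * T * \<kappa> / 2) \<le> cmod ?X" .
  have "cmod ?Y = \<delta> * \<kappa> * cmod (cis (- ?\<sigma> * T) - 1)"
    using \<delta> \<kappa> by (simp add: norm_mult)
  also have "\<dots> \<le> \<delta> * \<kappa> * (\<bar>?\<sigma>\<bar> * T)"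
    using \<delta> \<kappa> norm_cis_phase_le[OF T_nonneg] by (intro mult_left_mono) auto
  also have "\<bar>?\<sigma>\<bar> * T = \<delta> powr a * T * \<kappa> powr a"
    using mu \<delta> \<kappa> by (simp add: abs_mult powr_mult)
  also have "\<delta> * \<kappa> * (\<delta> powr a * T * \<kappa> powr a) \<le> \<delta> * \<kappa> * (\<delta> powr a * T * (1/4))"
    using \<delta> \<kappa> T_nonneg by (intro mult_left_mono \<kappa>_small) auto
  finally have "cmod ?Y \<le> \<delta> * \<kappa> * (\<delta> powr a * T * (1/4))" .
  with X norm_triangle_ineq2[of ?X ?Y] show ?thesis unfolding eq by (simp add: algebra_simps)
qed

end

section \<open>Choice of the parameters\<close>

lemma ksq_eq_norm: "ksq k = (norm (\<chi> i. real_of_int (k $ i)))\<^sup>2"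
  by (simp add: ksq_def norm_vec_def L2_set_def sum_nonneg)

lemma ksq_nonneg: "0 \<le> ksq k" by (simp add: ksq_eq_norm)

lemma ksq_axis: "ksq (axis j n) = (real_of_int n)\<^sup>2"
  unfolding ksq_def by (subst sum.remove[of _ j]) (auto simp: axis_def)

lemma sqrt_ksq_add_le: "sqrt (ksq (k + l)) \<le> sqrt (ksq k) + sqrt (ksq l)"
proof -
  have "(\<chi> i. real_of_int ((k + l) $ i)) = (\<chi> i. real_of_int (k $ i)) + (\<chi> i. real_of_int (l $ i))"
    by (simp add: vec_eq_iff)
  then show ?thesis by (simp add: ksq_eq_norm norm_triangle_ineq)
qed

text \<open>Rescaling by \<open>N\<close> keeps the weight of the frequency \<open>N\<close> bounded as \<open>N \<longrightarrow> \<infinity>\<close>.\<close>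
definition scaled_weight :: "real \<Rightarrow> real \<Rightarrow> int^'d \<Rightarrow> real" where
  "scaled_weight N s k = (1 + sqrt (ksq k) / N) powr s"

text \<open>Submultiplicativity combines the triangle inequality for frequencies with 1 + p + q <=
  (1 + p)(1 + q).\<close>

lemma wiener_weight_scaled:
  assumes "0 \<le> T" "0 < N" "0 \<le> s"
  shows "wiener_weight T (scaled_weight N s)"
proof
  show "scaled_weight N s 0 = 1" by (simp add: scaled_weight_def ksq_def)
  show "1 \<le> scaled_weight N s k" for k :: "int^'d"
    unfolding scaled_weight_def using assms ksq_nonneg[of k] by (intro ge_one_powr_ge_zero) auto
  show "scaled_weight N s (- k) = scaled_weight N s k" for k :: "int^'d"
    by (simp add: scaled_weight_def ksq_def)
  show "scaled_weight N s (k + l) \<le> scaled_weight N s k * scaled_weight N s l" for k l :: "int^'d"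
  proof -
    let ?p = "sqrt (ksq k) / N" and ?q = "sqrt (ksq l) / N"
    have pq: "0 \<le> ?p" "0 \<le> ?q" using assms ksq_nonneg[of k] ksq_nonneg[of l] by simp_all
    have "sqrt (ksq (k + l)) / N \<le> ?p + ?q"
      using divide_right_mono[OF sqrt_ksq_add_le[of k l], of N] assms by (simp add: add_divide_distrib)
    moreover have "0 \<le> ?p * ?q" using pq by (rule mult_nonneg_nonneg)
    ultimately have "1 + sqrt (ksq (k + l)) / N \<le> (1 + ?p) * (1 + ?q)"
      by (simp only: ring_distribs)
    then have "(1 + sqrt (ksq (k + l)) / N) powr s \<le> ((1 + ?p) * (1 + ?q)) powr s"
      using assms ksq_nonneg[of "k + l"] by (intro powr_mono2) auto
    also have "\<dots> = (1 + ?p) powr s * (1 + ?q) powr s"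
      by (rule powr_mult)
    finally show ?thesis by (simp add: scaled_weight_def)
  qed
qed (rule assms)

lemma Hs_weight_le_scaled:
  assumes "1 \<le> N" "0 \<le> s"
  shows "(1 + ksq k) powr s \<le> (N powr s)\<^sup>2 * (scaled_weight N s k)\<^sup>2"
proof -
  let ?q = "sqrt (ksq k)"
  have q: "0 \<le> ?q" using ksq_nonneg[of k] by simp
  have "1 + ksq k = 1 + ?q\<^sup>2" using ksq_nonneg[of k] by simp
  also have "\<dots> \<le> (N + ?q)\<^sup>2"
  proof -
    have "1 \<le> N\<^sup>2" using assms by simp
    moreover have "0 \<le> 2 * N * ?q" using assms q by (intro mult_nonneg_nonneg) auto
    ultimately show ?thesis by (simp only: power2_sum)
  qed
  also have "N + ?q = N * (1 + ?q / N)" using assms by (simp add: field_simps)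
  finally have "(1 + ksq k) powr s \<le> ((N * (1 + ?q / N))\<^sup>2) powr s"
    using assms ksq_nonneg[of k] by (intro powr_mono2) auto
  also have "\<dots> = (N powr s * (1 + ?q / N) powr s)\<^sup>2"
    using assms q by (simp add: power2_eq_square powr_mult)
  finally show ?thesis by (simp add: scaled_weight_def power_mult_distrib)
qed

lemma Hs_norm_two_modes:
  assumes "l \<noteq> 0"
  shows "Hs_norm s (\<lambda>x. c + d * character l x) = sqrt ((cmod c)\<^sup>2 + (1 + ksq l) powr s * (cmod d)\<^sup>2)"
proof -
  let ?f = "\<lambda>x. c + d * character l x"
  have fc: "fcoeff ?f k = (if k = 0 then c else 0) + (if k = l then d else 0)" for k
  proof -
    have "fcoeff ?f k = fcoeff (\<lambda>x. c * character 0 x) k + fcoeff (\<lambda>x. d * character l x) k"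
      by (subst fcoeff_add[symmetric]) (auto intro!: continuous_intros)
    then show ?thesis by (simp only: fcoeff_cmult fcoeff_character) simp
  qed
  have "(Hs_weight s ?f has_sum (\<Sum>k\<in>{0, l}. Hs_weight s ?f k)) UNIV"
    by (rule has_sum_finite_neutralI) (auto simp: Hs_weight_def fc)
  then have "infsum (Hs_weight s ?f) UNIV = (\<Sum>k\<in>{0, l}. Hs_weight s ?f k)"
    by (rule infsumI)
  also have "\<dots> = (cmod c)\<^sup>2 + (1 + ksq l) powr s * (cmod d)\<^sup>2"
    using assms by (simp add: Hs_weight_def fc ksq_def)
  finally show ?thesis by (simp add: Hs_norm_def)
qed

lemma Hs_norm_ge_mode:
  assumes "in_Hs s f"
  shows "(1 + ksq k) powr (s / 2) * cmod (fcoeff f k) \<le> Hs_norm s f"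
proof -
  have "sum (Hs_weight s f) {k} \<le> infsum (Hs_weight s f) UNIV"
    by (rule finite_sum_le_infsum) (use assms in \<open>auto simp: in_Hs_def Hs_weight_def\<close>)
  moreover have "Hs_weight s f k = ((1 + ksq k) powr (s / 2) * cmod (fcoeff f k))\<^sup>2"
    by (simp add: Hs_weight_def power_mult_distrib power2_eq_square powr_add[symmetric])
  ultimately show ?thesis unfolding Hs_norm_def by (intro real_le_rsqrt) simp
qed

text \<open>Divided by \<delta>^a, the last inequality reads C \<delta>^(\<alpha> - a) < \<epsilon>
  T / 8, and its left side tends to 0 exactly because \<alpha> > a.\<close>

lemma small_background_exists:
  fixes a :: real
  assumes "0 < a" "a < \<alpha>" "0 < \<epsilon>" "0 < T" "0 < h"
  obtains \<delta> :: real where "0 < \<delta>" "\<delta> < \<epsilon> / 2" "\<delta> powr a * T \<le> h"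
    "C * \<delta> powr \<alpha> < \<epsilon> * (\<delta> powr a * T) / 8"
proof -
  have lim: "((\<lambda>\<delta>::real. c * \<delta> powr b) \<longlongrightarrow> 0) (at_right 0)" if "0 < b" for b c
  proof -
    have "((\<lambda>\<delta>::real. \<delta> powr b) \<longlongrightarrow> 0) (at_right 0)"
      using that by (intro tendsto_zero_powrI[where b=b]) (auto simp: eventually_at_right_less intro: eventually_mono[OF eventually_at_right_less])
    then have "((\<lambda>\<delta>::real. c * \<delta> powr b) \<longlongrightarrow> c * 0) (at_right 0)" by (intro tendsto_intros)
    then show ?thesis by simp
  qed
  have "\<forall>\<^sub>F \<delta> in at_right 0. T * \<delta> powr a < h"
    by (rule order_tendstoD(2)[OF lim]) (use assms in auto)
  moreover have "\<forall>\<^sub>F \<delta> in at_right 0. C * \<delta> powr (\<alpha> - a) < \<epsilon> * T / 8"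
    by (rule order_tendstoD(2)[OF lim]) (use assms in auto)
  moreover have "\<forall>\<^sub>F \<delta> in at_right 0. \<delta> < \<epsilon> / 2"
    using eventually_at_right_real[of 0 "\<epsilon> / 2"] assms by (auto elim: eventually_mono)
  moreover have "\<forall>\<^sub>F \<delta>::real in at_right 0. 0 < \<delta>" by (rule eventually_at_right_less)
  ultimately have "\<forall>\<^sub>F \<delta> in at_right 0. 0 < \<delta> \<and> \<delta> < \<epsilon> / 2 \<and> T * \<delta> powr a < h \<and> C * \<delta> powr (\<alpha> - a) < \<epsilon> * T / 8"
    by eventually_elim auto
  then obtain \<delta> where \<delta>: "0 < \<delta>" "\<delta> < \<epsilon> / 2" "T * \<delta> powr a < h" "C * \<delta> powr (\<alpha> - a) < \<epsilon> * T / 8"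
    using eventually_happens'[of "at_right (0::real)"] by auto
  have "(C * \<delta> powr (\<alpha> - a)) * \<delta> powr a < (\<epsilon> * T / 8) * \<delta> powr a"
    using \<delta> by (intro mult_strict_right_mono) auto
  then have "C * \<delta> powr \<alpha> < \<epsilon> * (\<delta> powr a * T) / 8"
    by (simp add: mult.assoc powr_add[symmetric] mult_ac)
  with \<delta> show thesis by (intro that[of \<delta>]) (auto simp: mult_ac)
qed

lemma high_frequency_exists:
  fixes s c h :: real
  assumes "0 < s" "0 < h"
  obtains N :: nat where "1 \<le> N" "c * (1 + (real N)\<^sup>2) powr (- s / 2) \<le> h"
proof -
  have "real N \<le> 1 + (real N)\<^sup>2" for N
    using sum_power2_ge_zero[of "real N - 1" 0] by (simp add: power2_diff)
  then have "filterlim (\<lambda>N. 1 + (real N)\<^sup>2) at_top sequentially"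
    by (intro filterlim_at_top_mono[OF filterlim_real_sequentially] always_eventually) auto
  then have "((\<lambda>N. (1 + (real N)\<^sup>2) powr (- s / 2)) \<longlonglongrightarrow> 0)"
    using assms by (intro tendsto_neg_powr) auto
  then have "((\<lambda>N. c * (1 + (real N)\<^sup>2) powr (- s / 2)) \<longlonglongrightarrow> c * 0)" by (intro tendsto_intros)
  then have "\<forall>\<^sub>F N in sequentially. c * (1 + (real N)\<^sup>2) powr (- s / 2) < h"
    using assms by (intro order_tendstoD) auto
  moreover have "\<forall>\<^sub>F N::nat in sequentially. 1 \<le> N" by (rule eventually_ge_at_top)
  ultimately have "\<forall>\<^sub>F N in sequentially. 1 \<le> N \<and> c * (1 + (real N)\<^sup>2) powr (- s / 2) < h"
    by eventually_elim auto
  then obtain N where "1 \<le> N \<and> c * (1 + (real N)\<^sup>2) powr (- s / 2) < h"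
    using eventually_happens'[of sequentially] by auto
  then show thesis by (intro that[of N]) auto
qed

theorem theorem1p3:
  fixes a s \<alpha> mu :: real
  assumes "0 < a" and "a < 1"
    and "s = real CARD('d) / 2 - 2 / a"
    and "0 < s" and "s < 1 + 1 / a"
    and "\<alpha> > a"
    and "mu = 1 \<or> mu = -1"
  shows "\<not> (\<exists>\<epsilon>>0. \<exists>T>0. \<exists>C::real.
           \<forall>(u0::real^'d \<Rightarrow> complex) v0 u v.
             in_Hs s u0 \<and> in_Hs s v0 \<and> Hs_norm s u0 < \<epsilon> \<and> Hs_norm s v0 < \<epsilon> \<and>
             nls_solution mu a s T u0 u \<and> nls_solution mu a s T v0 v \<longrightarrow>
             (\<forall>t\<in>{0..T}. Hs_norm s (u t - v t) \<le> C * Hs_norm s (u0 - v0) powr \<alpha>))"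
proof
  assume "\<exists>\<epsilon>>0. \<exists>T>0. \<exists>C::real.
           \<forall>(u0::real^'d \<Rightarrow> complex) v0 u v.
             in_Hs s u0 \<and> in_Hs s v0 \<and> Hs_norm s u0 < \<epsilon> \<and> Hs_norm s v0 < \<epsilon> \<and>
             nls_solution mu a s T u0 u \<and> nls_solution mu a s T v0 v \<longrightarrow>
             (\<forall>t\<in>{0..T}. Hs_norm s (u t - v t) \<le> C * Hs_norm s (u0 - v0) powr \<alpha>)"
  then obtain \<epsilon> T C :: real where \<epsilon>: "0 < \<epsilon>" and T: "0 < T"
    and hoelder: "\<And>(u0::real^'d \<Rightarrow> complex) v0 u v t.
      \<lbrakk>in_Hs s u0; in_Hs s v0; Hs_norm s u0 < \<epsilon>; Hs_norm s v0 < \<epsilon>;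
       nls_solution mu a s T u0 u; nls_solution mu a s T v0 v; t \<in> {0..T}\<rbrakk>
      \<Longrightarrow> Hs_norm s (u t - v t) \<le> C * Hs_norm s (u0 - v0) powr \<alpha>"
    by blast
  let ?w = "2 powr s :: real" and ?K = lipschitz_const
  have w: "1 \<le> ?w" using assms by (intro ge_one_powr_ge_zero) auto
  have K: "0 \<le> ?K" by (rule lipschitz_const_nonneg)
  \<comment> \<open>The weight of \<open>l\<close> will be \<open>?w\<close>. This choice limits the
    remainder term in \<open>small\<close> to 2 * 1/8, half of what is allowed;
    \<open>?K + 1\<close> keeps the denominator positive.\<close>
  define r where "r = min (1/2) (1 / (8 * ?w * (?K + 1)))"
  have wK: "0 < ?w * (?K + 1)" using w K by simp
  have r: "0 < r" "r \<le> 1/2" using w K by (auto simp: r_def)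
  have wKr: "?w * (?K * r) \<le> 1/8"
  proof -
    have "?w * (?K * r) \<le> (?w * (?K + 1)) * r"
      using r w K by (simp add: algebra_simps)
    also have "\<dots> \<le> (?w * (?K + 1)) * (1 / (8 * ?w * (?K + 1)))"
      using wK by (intro mult_left_mono) (auto simp: r_def)
    also have "\<dots> = 1/8" using wK by (simp add: field_simps)
    finally show ?thesis .
  qed
  have Kr: "?K * r \<le> 1"
  proof -
    have "1 * (?K * r) \<le> ?w * (?K * r)" using w K r by (intro mult_right_mono) auto
    with wKr show ?thesis by simp
  qed
  \<comment> \<open>The background may use half of the radius \<open>r\<close>. As 48 = 4 * 12, its
    term in \<open>small\<close> is at most 1/4, the other half of the allowance.\<close>
  define h where "h = min (r / 2) (1 / (48 * ?w))"
  have h: "0 < h" "h \<le> r / 2" "?w * h \<le> 1/48"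
    using r w by (auto simp: h_def min_def field_simps)
  \<comment> \<open>The factor 1/8 is the 1/4 of \<open>solution_mode_gap\<close> times the H^s size
    \<epsilon>/2 of the plane wave.\<close>
  obtain \<delta> where \<delta>: "0 < \<delta>" and \<delta>_less: "\<delta> < \<epsilon> / 2" and \<delta>_small: "\<delta> powr a * T \<le> h"
    and gap: "C * \<delta> powr \<alpha> < \<epsilon> * (\<delta> powr a * T) / 8"
    using small_background_exists[of a \<alpha> \<epsilon> T h C] assms \<epsilon> T h by metis
  \<comment> \<open>An upper bound for \<kappa>: the first entry fits the wave into the remaining
    half of \<open>r\<close>, the second gives \<open>\<kappa> powr a \<le> 1/4\<close>.\<close>
  define h' where "h' = min (r / (4 * ?w)) ((1/4) powr (1 / a))"
  have h': "0 < h'" "2 * (?w * h') \<le> r / 2" "h' powr a \<le> 1/4"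
  proof -
    show "0 < h'" using r w by (auto simp: h'_def)
    have "?w * h' \<le> ?w * (r / (4 * ?w))" using w by (intro mult_left_mono) (auto simp: h'_def)
    then show "2 * (?w * h') \<le> r / 2" by simp
    have "h' powr a \<le> ((1/4) powr (1 / a)) powr a"
      using \<open>0 < h'\<close> assms by (intro powr_mono2) (auto simp: h'_def)
    then show "h' powr a \<le> 1/4" using assms by (simp add: powr_powr)
  qed
  obtain N :: nat where N: "1 \<le> N" "\<epsilon> / 2 / \<delta> * (1 + (real N)\<^sup>2) powr (- s / 2) \<le> h'"
    using high_frequency_exists[OF \<open>0 < s\<close> h'(1)] by metis
  \<comment> \<open>Normalised so that \<open>A = \<delta> * \<kappa>\<close> gives the plane wave
    H^s norm \<epsilon>/2 whatever N is.\<close>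
  define \<kappa> where "\<kappa> = \<epsilon> / 2 / \<delta> * (1 + (real N)\<^sup>2) powr (- s / 2)"
  define A where "A = \<delta> * \<kappa>"
  \<comment> \<open>Here \<open>undefined\<close> is some coordinate direction; no property of the
    choice enters.\<close>
  define l :: "int^'d" where "l = axis undefined (int N)"
  define W :: "int^'d \<Rightarrow> real" where "W = scaled_weight N s"
  have ksq_l: "ksq l = (real N)\<^sup>2" by (simp add: l_def ksq_axis)
  have l: "l \<noteq> 0"
    using ksq_l N by (auto simp: ksq_def)
  have Wl: "W l = ?w" using N by (simp add: W_def scaled_weight_def ksq_l)
  have one_N: "0 < 1 + (real N)\<^sup>2" by (simp add: add_pos_nonneg)
  have \<kappa>: "0 < \<kappa>" "\<kappa> \<le> h'" using \<epsilon> \<delta> N one_N by (simp_all add: \<kappa>_def)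
  have \<kappa>w: "2 * (W l * \<kappa>) \<le> r / 2"
  proof -
    have "2 * (?w * \<kappa>) \<le> 2 * (?w * h')" using \<kappa> w by (intro mult_left_mono) auto
    with h'(2) show ?thesis unfolding Wl by linarith
  qed
  have \<kappa>a: "\<kappa> powr a \<le> 1/4"
    using powr_mono2[of a \<kappa> h'] \<kappa> h' assms by simp
  have A: "0 < A" using \<delta> \<kappa> by (simp add: A_def)
  have A_N: "(1 + ksq l) powr (s / 2) * A = \<epsilon> / 2"
    using \<delta> one_N by (simp add: A_def \<kappa>_def ksq_l powr_minus field_simps)
  have A_Hs: "(1 + ksq l) powr s * A\<^sup>2 = (\<epsilon> / 2)\<^sup>2"
    unfolding A_N[symmetric] by (simp add: power_mult_distrib power2_eq_square powr_add[symmetric])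
  have hs: "(1 + ksq k) powr s \<le> ((real N) powr s)\<^sup>2 * (W k)\<^sup>2" for k
    unfolding W_def by (rule Hs_weight_le_scaled) (use N assms in auto)
  interpret wiener_weight T W
    unfolding W_def by (rule wiener_weight_scaled) (use N assms T in auto)
  have wh: "?w * (\<delta> powr a * T) \<le> 1/48"
    using order_trans[OF mult_left_mono[OF \<delta>_small, of ?w] h(3)] w by simp
  interpret perturbed_wave T W a mu \<delta> \<kappa> r l
  proof
    show "\<delta> powr a * T + 2 * (W l * \<kappa>) \<le> r" using \<delta>_small h(2) \<kappa>w by simp
    have "1 * (\<delta> powr a * T) \<le> ?w * (\<delta> powr a * T)" using w T by (intro mult_right_mono) auto
    with wh show "\<delta> powr a * T \<le> 1/6" by simp
  qed (use assms \<delta> \<kappa> l r Kr in auto)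
  have small: "W l * (12 * (\<delta> powr a * T) + 2 * (?K * r)) \<le> 1/2"
    using wh wKr by (simp add: Wl algebra_simps)
  \<comment> \<open>The summand 0 in \<open>v0\<close> gives both data the form required by
    \<open>Hs_norm_two_modes\<close>.\<close>
  define u0 v0 :: "real^'d \<Rightarrow> complex" where
    "u0 = (\<lambda>x. of_real \<delta> + of_real A * character l x)" and "v0 = (\<lambda>x. 0 + of_real A * character l x)"
  define v where "v = (\<lambda>t x. of_real A * cis (- (ksq l + mu * A powr a) * t) * character l x)"
  have "nls_solution mu a s T (\<lambda>x. of_real \<delta> * (1 + of_real \<kappa> * character l x)) solution"
    using hs by (rule solution_is_nls_solution)
  then have u: "nls_solution mu a s T u0 solution"
    by (simp add: u0_def A_def algebra_simps)
  have v: "wiener_bound (W l * A) v" "nls_solution mu a s T v0 v"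
    using plane_wave_solution[OF hs A, where l=l and mu=mu and a=a] by (simp_all add: v_def v0_def)
  have T0: "T \<in> {0..T}" using T by simp
  have Hs: "in_Hs s (\<lambda>x. of_real c + of_real A * character l x)" for c
    by (rule wiener_bound_in_Hs[OF hs wiener_bound_add[OF wiener_bound_const wiener_bound_character] T0]) auto
  have "Hs_norm s (solution T - v T) \<le> C * Hs_norm s (u0 - v0) powr \<alpha>"
  proof (rule hoelder[OF _ _ _ _ u v(2) T0])
    show "in_Hs s u0" "in_Hs s v0"
      using Hs[of \<delta>] Hs[of 0] by (simp_all add: u0_def v0_def)
    show "Hs_norm s v0 < \<epsilon>"
      unfolding v0_def Hs_norm_two_modes[OF l] using A_Hs \<epsilon> by simp
    \<comment> \<open>Constant and plane wave are orthogonal, and each has norm at most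
      \<epsilon>/2.\<close>
    have "\<delta>\<^sup>2 \<le> (\<epsilon> / 2)\<^sup>2" using \<delta> \<delta>_less by (intro power_mono) auto
    then have "\<delta>\<^sup>2 + (\<epsilon> / 2)\<^sup>2 < \<epsilon>\<^sup>2" using zero_less_power[OF \<epsilon>, of 2] by (simp only: power_divide power2_eq_square[of "2::real"])
    then have "sqrt (\<delta>\<^sup>2 + (\<epsilon> / 2)\<^sup>2) < \<epsilon>" using \<epsilon> by (intro real_less_lsqrt) auto
    then show "Hs_norm s u0 < \<epsilon>"
      unfolding u0_def Hs_norm_two_modes[OF l] using A_Hs \<delta> by simp
  qed
  moreover have "Hs_norm s (u0 - v0) = \<delta>"
  proof -
    have "u0 - v0 = (\<lambda>x. of_real \<delta> + 0 * character l x)" by (auto simp: u0_def v0_def)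
    then show ?thesis using \<delta> by (simp only: Hs_norm_two_modes[OF l]) simp
  qed
  \<comment> \<open>Mode \<open>l\<close> alone bounds the norm from below: its weight turns the
    amplitude \<open>A\<close> into \<epsilon>/2, so the gap is independent of N.\<close>
  moreover have "\<epsilon> * (\<delta> powr a * T) / 8 \<le> Hs_norm s (solution T - v T)"
  proof -
    have d: "in_Hs s (solution T - v T)"
      using wiener_bound_in_Hs[OF hs wiener_bound_diff[OF wiener_bound_solution v(1)] T0] by (simp add: fun_diff_def)
    have "fcoeff (solution T - v T) l = fcoeff (solution T) l - fcoeff (v T) l"
      unfolding fun_diff_def
      by (rule fcoeff_diff[OF wiener_bound_continuous[OF wiener_bound_solution T0] wiener_bound_continuous[OF v(1) T0]])
    also have "fcoeff (v T) l = of_real (\<delta> * \<kappa>) * cis (- (ksq l + mu * (\<delta> * \<kappa>) powr a) * T)"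
      unfolding v_def fcoeff_cmult fcoeff_character by (simp add: A_def)
    finally have "A * (\<delta> powr a * T) / 4 \<le> cmod (fcoeff (solution T - v T) l)"
      using solution_mode_gap[OF small \<kappa>a] by (simp add: A_def fun_diff_def)
    then have "(1 + ksq l) powr (s / 2) * (A * (\<delta> powr a * T) / 4)
        \<le> (1 + ksq l) powr (s / 2) * cmod (fcoeff (solution T - v T) l)"
      by (rule mult_left_mono) simp
    also have "\<dots> \<le> Hs_norm s (solution T - v T)" by (rule Hs_norm_ge_mode[OF d])
    also have "(1 + ksq l) powr (s / 2) * (A * (\<delta> powr a * T) / 4) = ((1 + ksq l) powr (s / 2) * A) * (\<delta> powr a * T) / 4"
      by simp
    finally show ?thesis unfolding A_N by (simp add: fun_diff_def)
  qed
  ultimately show False using gap by simp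
qed

end
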